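(* For any real numbers $p\geq1$ and $\sigma\geq1/2$, one has \[ \sup_{0\neq V\in L^{p}(\mathbb{R})}\frac{1}{\|V\|_{L^{p}}^{p}}\sum_{\lambda\in\sigma_{d}(H)}\frac{\left(\operatorname{dist}(\lambda,[0,\infty))\right)^{p}}{|\lambda|^{\sigma}}=\infty, \] where the supremum is over complex-valued potentials $V\in L^p(\mathbb{R})$ and $H=-\frac{\mathrm{d}^2}{\mathrm{d}x^2}+V$ is the one-dimensional Schrödinger operator on $L^2(\mathbb{R})$ with potential $V$.
   Context: For complex-valued $V\in L^p(\mathbb{R})$, $p\geq1$, the operator $H=-\frac{\mathrm{d}^2}{\mathrm{d}x^2}+V$ in $L^2(\mathbb{R})$ is understood in the usual way as the m-sectorial operator associated with the closed sectorial form $\psi\mapsto\int_{\mathbb{R}}|\psi'|^2\,\mathrm{d}x+\int_{\mathbb{R}}V|\psi|^2\,\mathrm{d}x$ on the Sobolev space $H^1(\mathbb{R})$ (for bounded $V$ this is the operator sum with domain $H^2(\mathbb{R})$). Its essential spectrum is $[0,\infty)$, and its discrete spectrum is $\sigma_d(H)=\sigma(H)\setminus[0,\infty)$, an at most countable set of eigenvalues. The sum runs over the elements of the set $\sigma_d(H)$ and takes values in $[0,\infty]$. *)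

theory Defs
  imports "HOL-Analysis.Analysis"
begin

text \<open>
  Elements of $L^p(\mathbb{R})$ are represented by Borel functions rather than by classes
  modulo equality almost everywhere; every class has a Borel representative, and all notions
  below are invariant under changing a function on a null set.
\<close>

definition Lp :: "real \<Rightarrow> (real \<Rightarrow> complex) set" where
  "Lp p = {f \<in> borel_measurable lborel. integrable lborel (\<lambda>x. cmod (f x) powr p)}"

definition Lp_norm :: "real \<Rightarrow> (real \<Rightarrow> complex) \<Rightarrow> real" where
  "Lp_norm p f = (\<integral>x. cmod (f x) powr p \<partial>lborel) powr (1 / p)"

definition L2_inner :: "(real \<Rightarrow> complex) \<Rightarrow> (real \<Rightarrow> complex) \<Rightarrow> complex" where
  "L2_inner f g = (\<integral>x. f x * cnj (g x) \<partial>lborel)"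

text \<open>
  Weak derivatives in one dimension, tested against $C^1_c(\mathbb{R})$ as in Brezis,
  Functional Analysis, Sobolev Spaces and Partial Differential Equations, Chapter 8
  (by mollification, $C^\infty_c(\mathbb{R})$ gives the same notion).
\<close>

definition test_functions :: "(real \<Rightarrow> complex) set" where
  "test_functions = {\<phi>. \<phi> C1_differentiable_on UNIV \<and> compact (closure {x. \<phi> x \<noteq> 0})}"

definition has_weak_deriv :: "(real \<Rightarrow> complex) \<Rightarrow> (real \<Rightarrow> complex) \<Rightarrow> bool" where
  "has_weak_deriv u g \<longleftrightarrow>
     (\<forall>\<phi>\<in>test_functions.
        (\<integral>x. u x * vector_derivative \<phi> (at x) \<partial>lborel) = - (\<integral>x. g x * \<phi> x \<partial>lborel))"

definition H1 :: "(real \<Rightarrow> complex) set" where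
  "H1 = {u \<in> Lp 2. \<exists>g\<in>Lp 2. has_weak_deriv u g}"

text \<open>The weak derivative is unique up to null sets, so the choice below is immaterial.\<close>

definition weak_deriv :: "(real \<Rightarrow> complex) \<Rightarrow> real \<Rightarrow> complex" where
  "weak_deriv u = (SOME g. g \<in> Lp 2 \<and> has_weak_deriv u g)"

text \<open>
  The sesquilinear form polarising
  $\psi \mapsto \int |\psi'|^2 + \int V |\psi|^2$, linear in the first argument.
\<close>

definition schroedinger_form ::
  "(real \<Rightarrow> complex) \<Rightarrow> (real \<Rightarrow> complex) \<Rightarrow> (real \<Rightarrow> complex) \<Rightarrow> complex" where
  "schroedinger_form V u v =
     (\<integral>x. weak_deriv u x * cnj (weak_deriv v x) \<partial>lborel) + (\<integral>x. V x * u x * cnj (v x) \<partial>lborel)"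

text \<open>
  Operators in $L^2(\mathbb{R})$ are represented by their graphs. The operator associated with
  a form \<open>a\<close> with domain \<open>D\<close> is the one of the first representation theorem:
  \<open>u \<in> D\<close> lies in its domain and is mapped to \<open>f\<close> iff \<open>a u v = \<langle>f, v\<rangle>\<close> for all \<open>v \<in> D\<close>.
\<close>

type_synonym L2_operator = "((real \<Rightarrow> complex) \<times> (real \<Rightarrow> complex)) set"

definition form_operator ::
  "(real \<Rightarrow> complex) set \<Rightarrow> ((real \<Rightarrow> complex) \<Rightarrow> (real \<Rightarrow> complex) \<Rightarrow> complex) \<Rightarrow> L2_operator" where
  "form_operator D a = {(u, f). u \<in> D \<and> f \<in> Lp 2 \<and> (\<forall>v\<in>D. a u v = L2_inner f v)}"

definition schroedinger_operator :: "(real \<Rightarrow> complex) \<Rightarrow> L2_operator" where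
  "schroedinger_operator V = form_operator H1 (schroedinger_form V)"

text \<open>
  \<open>z\<close> is in the resolvent set of \<open>A\<close> iff \<open>A - z\<close> maps the domain of \<open>A\<close> onto $L^2(\mathbb{R})$
  and has a bounded inverse; the bound contains injectivity modulo null sets.
\<close>

definition resolvent_set :: "L2_operator \<Rightarrow> complex set" where
  "resolvent_set A =
     {z. (\<forall>f\<in>Lp 2. \<exists>(u, g)\<in>A. AE x in lborel. g x - z * u x = f x) \<and>
         (\<exists>C. \<forall>(u, g)\<in>A. Lp_norm 2 u \<le> C * Lp_norm 2 (\<lambda>x. g x - z * u x))}"

definition spectrum :: "L2_operator \<Rightarrow> complex set" where
  "spectrum A = - resolvent_set A"

text \<open>The essential spectrum of the Schroedinger operators considered here is $[0,\infty)$.\<close>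

definition discrete_spectrum :: "(real \<Rightarrow> complex) \<Rightarrow> complex set" where
  "discrete_spectrum V = spectrum (schroedinger_operator V) - \<real>\<^sub>\<ge>\<^sub>0"

end

theory Submission
  imports Defs
begin

text \<open>
  Let \<open>V = \<i>h\<close> on $[-1,1]$ and \<open>V = 0\<close> elsewhere. An odd eigenfunction is a sine of frequency
  \<open>\<kappa>\<close> inside the well glued to $e^{ikx}$ outside, where $k^2 = \kappa^2 + \mathrm{i}h$ is the
  eigenvalue. In terms of $w = \kappa + k$ the matching condition reads $e^{2\mathrm{i}\kappa} = w^2/(\mathrm{i}h)$,
  and taking logarithms turns it, for each integer $n$, into the fixed point equation
  $w = 2\pi n + \mathrm{i}h/w - \mathrm{i}(2 \log w - \log(\mathrm{i}h))$, whose right-hand side is a contraction near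
  $2\pi n$ as soon as $n \ge \sqrt h$. For $\sqrt h \le n \le h^{3/4}$ the resulting eigenvalue has imaginary
  part at least $h/4$ and modulus $O(n^2)$, so for \<open>\<sigma> = 1/2\<close> the sum is at least a constant times
  $h^p \sum 1/n$, which exceeds $\|V\|_p^p = 2h^p$ by a factor of order $\log h$. Dilating the well so that
  these eigenvalues lie in the unit disc gives the same lower bound for every \<open>\<sigma> \<ge> 1/2\<close>.
\<close>

section \<open>Square-integrable functions and weak derivatives\<close>

text \<open>Only a lower bound is needed, so it suffices to exhibit enough distinct eigenvalues; the
  rest of the spectrum is never described. Distinctness needs an argument, because the sum runs over
  a set and the balls containing the fixed points overlap. The analytic obstacle is the form
  definition of the operator: an eigenfunction must satisfy the form identity against every
  \<open>v\<close> in \<open>H1\<close>, whose weak derivative is known only through compactly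
  supported C^1 tests. The natural test is the conjugate of the eigenfunction's derivative, which
  has corners at the edges of the well and exponential tails. The admissible tests are therefore
  widened twice: to Lipschitz functions, then to unbounded support. The range of \<open>n\<close>
  has two causes. Below the order of sqrt h the term \<open>h/w\<close> is no longer a contraction.
  For large \<open>n\<close> the logarithm pulls \<open>w\<close> downwards and lowers the imaginary
  part of the eigenvalue by an amount of order \<open>n * ln n\<close>, which must stay below
  \<open>h\<close>; stopping at h^(3/4) leaves ample room. The exponent 1/2 is critical because
  there the quotient is invariant under dilation, while sqrt of the modulus is of order
  \<open>n\<close> and the sum becomes harmonic.\<close>

lemma Lp2_iff: "f \<in> Lp 2 \<longleftrightarrow> f \<in> borel_measurable lborel \<and> integrable lborel (\<lambda>x. (cmod (f x))\<^sup>2)"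
  by (simp add: Lp_def)

lemma Lp2_measurable [measurable_dest]: "f \<in> Lp 2 \<Longrightarrow> f \<in> borel_measurable borel"
  by (simp add: Lp2_iff)

lemma Lp2_product_integrable:
  assumes "f \<in> Lp 2" "g \<in> Lp 2"
  shows "integrable lborel (\<lambda>x. f x * g x)"
proof (rule Bochner_Integration.integrable_bound)
  note [measurable] = assms
  show "integrable lborel (\<lambda>x. (cmod (f x))\<^sup>2 + (cmod (g x))\<^sup>2)"
    using assms by (simp add: Lp2_iff)
  show "(\<lambda>x. f x * g x) \<in> borel_measurable lborel"
    by measurable
  have "cmod (f x * g x) \<le> (cmod (f x))\<^sup>2 + (cmod (g x))\<^sup>2" for x
    using sum_squares_bound[of "cmod (f x)" "cmod (g x)"]
      mult_nonneg_nonneg[OF norm_ge_zero[of "f x"] norm_ge_zero[of "g x"]]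
    unfolding norm_mult by linarith
  then show "AE x in lborel. norm (f x * g x) \<le> norm ((cmod (f x))\<^sup>2 + (cmod (g x))\<^sup>2)"
    by simp
qed

lemma Lp2_bounded:
  assumes [measurable]: "f \<in> borel_measurable borel" and "g \<in> Lp 2"
    and "\<And>x. cmod (f x) \<le> C * cmod (g x)"
  shows "f \<in> Lp 2"
proof -
  have "integrable lborel (\<lambda>x. (cmod (f x))\<^sup>2)"
  proof (rule Bochner_Integration.integrable_bound)
    show "integrable lborel (\<lambda>x. C\<^sup>2 * (cmod (g x))\<^sup>2)"
      using assms(2) by (simp add: Lp2_iff)
    have "(cmod (f x))\<^sup>2 \<le> (C * cmod (g x))\<^sup>2" for x
      using assms(3) by (intro power_mono) auto
    then show "AE x in lborel. norm ((cmod (f x))\<^sup>2) \<le> norm (C\<^sup>2 * (cmod (g x))\<^sup>2)"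
      by (simp add: power_mult_distrib)
  qed simp
  then show ?thesis
    by (simp add: Lp2_iff)
qed

lemma Lp2_indicator: "(indicator {a..b::real} :: real \<Rightarrow> complex) \<in> Lp 2"
proof -
  have "(\<lambda>x. (cmod (indicator {a..b} x))\<^sup>2) = indicat_real {a..b}"
    by (auto simp: indicator_def)
  moreover have "integrable lborel (indicat_real {a..b})"
    by (intro integrable_real_indicator) (auto simp: emeasure_lborel_Icc_eq)
  ultimately show ?thesis
    by (simp add: Lp2_iff)
qed

lemma Lp2_diff:
  assumes "f \<in> Lp 2" "g \<in> Lp 2"
  shows "(\<lambda>x. f x - g x) \<in> Lp 2"
proof -
  note [measurable] = assms
  have "integrable lborel (\<lambda>x. (cmod (f x - g x))\<^sup>2)"
  proof (rule Bochner_Integration.integrable_bound)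
    show "integrable lborel (\<lambda>x. 2 * ((cmod (f x))\<^sup>2 + (cmod (g x))\<^sup>2))"
      using assms by (simp add: Lp2_iff)
    have "(cmod (f x - g x))\<^sup>2 \<le> 2 * ((cmod (f x))\<^sup>2 + (cmod (g x))\<^sup>2)" for x
    proof -
      have "(cmod (f x - g x))\<^sup>2 \<le> (cmod (f x) + cmod (g x))\<^sup>2"
        by (intro power_mono norm_triangle_ineq4) auto
      then show ?thesis
        using sum_squares_bound[of "cmod (f x)" "cmod (g x)"] by (simp add: power2_sum)
    qed
    then show "AE x in lborel. norm ((cmod (f x - g x))\<^sup>2)
        \<le> norm (2 * ((cmod (f x))\<^sup>2 + (cmod (g x))\<^sup>2))"
      by simp
  qed measurable
  then show ?thesis
    by (simp add: Lp2_iff)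
qed

lemma Lp2_cnj: "f \<in> Lp 2 \<Longrightarrow> (\<lambda>x. cnj (f x)) \<in> Lp 2"
  by (rule Lp2_bounded[of _ f 1])
    (auto intro!: borel_measurable_continuous_on[of cnj] continuous_intros simp: Lp2_iff)

section \<open>From C^1 test functions to Lipschitz test functions of bounded support\<close>

lemma test_functionI:
  assumes "\<And>x. (\<phi> has_vector_derivative \<psi> x) (at x)" "continuous_on UNIV \<psi>"
    and "\<And>x. \<bar>x\<bar> > R \<Longrightarrow> \<phi> x = 0"
  shows "\<phi> \<in> test_functions"
proof -
  have "{x. \<phi> x \<noteq> 0} \<subseteq> cball 0 R"
    using assms(3) by (force simp: not_less)
  then have "compact (closure {x. \<phi> x \<noteq> 0})"
    by (meson bounded_cball bounded_subset compact_closure)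
  moreover have "\<phi> C1_differentiable_on UNIV"
    unfolding C1_differentiable_on_def using assms(1,2) by blast
  ultimately show ?thesis
    by (simp add: test_functions_def)
qed

text \<open>Mean value inequality for \<open>F t - t *\<^sub>R c\<close>. With
  \<open>c = \<phi> x\<close> it says that an average of \<phi> over an interval starting at
  \<open>x\<close> is as close to \<open>\<phi> x\<close> as \<phi> itself is on that
  interval.\<close>

lemma antiderivative_increment_bound:
  fixes F f :: "real \<Rightarrow> complex"
  assumes F: "\<And>t. (F has_vector_derivative f t) (at t)"
    and le: "x \<le> y" and bound: "\<And>t. x \<le> t \<Longrightarrow> t \<le> y \<Longrightarrow> cmod (f t - c) \<le> B"
  shows "cmod (F y - F x - (y - x) *\<^sub>R c) \<le> B * (y - x)"
proof -
  have "cmod ((F y - y *\<^sub>R c) - (F x - x *\<^sub>R c)) \<le> B * norm (y - x)"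
  proof (rule differentiable_bound[where S = "{x..y}" and f' = "\<lambda>t h. h *\<^sub>R (f t - c)"])
    fix t assume t: "t \<in> {x..y}"
    have "((\<lambda>t. F t - t *\<^sub>R c) has_vector_derivative f t - c) (at t within {x..y})"
      by (rule derivative_eq_intros has_vector_derivative_at_within[OF F] refl | simp)+
    then show "((\<lambda>t. F t - t *\<^sub>R c) has_derivative (\<lambda>h. h *\<^sub>R (f t - c))) (at t within {x..y})"
      by (simp add: has_vector_derivative_def)
    show "onorm (\<lambda>h. h *\<^sub>R (f t - c)) \<le> B"
      using bound[of t] t by (simp add: onorm_scaleR_left[of "\<lambda>x::real. x"] onorm_id)
  qed (use le in auto)
  then show ?thesis
    using le by (simp add: algebra_simps)
qed

text \<open>Averaging \<phi> over \<open>[x, x + h]\<close> gives a C^1 function whose derivative is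
  the difference quotient of \<phi>. These quotients are bounded by \<open>L\<close> and converge to
  \<psi> off the null set \<open>S\<close>, so the identity for the averages passes to the limit by
  dominated convergence.\<close>

lemma weak_deriv_test_Lipschitz:
  fixes \<phi> \<psi> :: "real \<Rightarrow> complex"
  assumes v: "v \<in> Lp 2" and g: "g \<in> Lp 2" and wd: "has_weak_deriv v g"
    and lip: "L-lipschitz_on UNIV \<phi>" and supp: "\<And>x. \<bar>x\<bar> > R \<Longrightarrow> \<phi> x = 0"
    and fin: "finite S"
    and der: "\<And>x. x \<notin> S \<Longrightarrow> (\<phi> has_vector_derivative \<psi> x) (at x)"
    and [measurable]: "\<psi> \<in> borel_measurable borel"
  shows "(\<integral>x. v x * \<psi> x \<partial>lborel) = - (\<integral>x. g x * \<phi> x \<partial>lborel)"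
proof -
  have L: "L \<ge> 0"
    using lip by (rule lipschitz_on_nonneg)
  have lipD: "cmod (\<phi> x - \<phi> y) \<le> L * \<bar>x - y\<bar>" for x y
    using lipschitz_onD[OF lip, of x y] by (simp add: dist_norm)
  have cont: "continuous_on UNIV \<phi>"
    using lip by (rule lipschitz_on_continuous_on)
  then have isCont: "isCont \<phi> x" for x
    by (simp add: continuous_on_eq_continuous_at)
  obtain F where F: "\<And>x. (F has_vector_derivative \<phi> x) (at x)"
    using einterval_antiderivative[of "-\<infinity>" "\<infinity>" \<phi>] isCont by auto
  note [measurable] = v g borel_measurable_continuous_onI[OF cont]
  define h where "h n = 1 / real (Suc n)" for n
  have h: "h n > 0" "h n \<le> 1" for n
    by (auto simp: h_def field_simps)
  have h0: "h \<longlonglongrightarrow> 0"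
    unfolding h_def by (rule LIMSEQ_Suc[OF lim_1_over_n])
  \<comment> \<open>Steklov means of \<open>\<phi>\<close>\<close>
  define \<phi>' where "\<phi>' n x = (1 / h n) *\<^sub>R (F (x + h n) - F x)" for n x
  define \<psi>' where "\<psi>' n x = (1 / h n) *\<^sub>R (\<phi> (x + h n) - \<phi> x)" for n x
  have der': "(\<phi>' n has_vector_derivative \<psi>' n x) (at x)" for n x
  proof -
    have "((\<lambda>x. F (x + h n)) has_vector_derivative \<phi> (x + h n)) (at x)"
      using vector_diff_chain_at[of "\<lambda>x. x + h n" 1 x F "\<phi> (x + h n)"] F
      by (auto simp: o_def has_vector_derivative_add_const)
    then show ?thesis
      unfolding \<phi>'_def \<psi>'_def
      by (intro bounded_linear.has_vector_derivative[OF bounded_linear_scaleR_right] has_vector_derivative_diff F)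
  qed
  have cont': "continuous_on UNIV (\<psi>' n)" for n
    unfolding \<psi>'_def by (intro continuous_intros continuous_on_compose2[OF cont]) auto
  have contphi': "continuous_on UNIV (\<phi>' n)" for n
    using der' by (meson continuous_at_imp_continuous_on has_vector_derivative_continuous)
  note [measurable] = borel_measurable_continuous_onI[OF cont'] borel_measurable_continuous_onI[OF contphi']
  have near: "cmod (\<phi>' n x - \<phi> x) \<le> B"
    if "\<And>t. x \<le> t \<Longrightarrow> t \<le> x + h n \<Longrightarrow> cmod (\<phi> t - \<phi> x) \<le> B" for n x B
  proof -
    define E where "E = F (x + h n) - F x - (x + h n - x) *\<^sub>R \<phi> x"
    have "cmod E \<le> B * (x + h n - x)"
      unfolding E_def
      by (rule antiderivative_increment_bound[OF F]) (use h(1)[of n] that in auto)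
    moreover have "\<phi>' n x - \<phi> x = (1 / h n) *\<^sub>R E"
      using h(1)[of n] by (simp add: \<phi>'_def E_def algebra_simps)
    ultimately show ?thesis
      using h(1)[of n] by (simp add: pos_divide_le_eq)
  qed
  have near1: "cmod (\<phi>' n x - \<phi> x) \<le> L * h n" for n x
  proof (rule near)
    fix t assume t: "x \<le> t" "t \<le> x + h n"
    have "L * \<bar>t - x\<bar> \<le> L * h n"
      using t L by (intro mult_left_mono) auto
    then show "cmod (\<phi> t - \<phi> x) \<le> L * h n"
      using lipD[of t x] by simp
  qed
  \<comment> \<open>Averaging over \<open>[x, x + h n]\<close> enlarges the support by at most
    \<open>h n\<close>, hence by at most 1, uniformly in \<open>n\<close>. One fixed interval can
    therefore be used in both dominating functions.\<close>
  have supp': "\<phi>' n x = 0" "\<psi>' n x = 0" if x: "\<bar>x\<bar> > R + 1" for n x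
  proof -
    have z: "\<phi> t = 0" if "x \<le> t" "t \<le> x + h n" for t
      using supp[of t] that x h(2)[of n] by auto
    then show "\<psi>' n x = 0"
      using h(1)[of n] by (simp add: \<psi>'_def)
    have "cmod (\<phi>' n x - \<phi> x) \<le> 0"
      using z h(1)[of n] by (intro near) auto
    then show "\<phi>' n x = 0"
      using z h(1)[of n] by simp
  qed
  have test: "\<phi>' n \<in> test_functions" for n
    using der' cont' supp'(1) by (rule test_functionI)
  have eq: "(\<integral>x. v x * \<psi>' n x \<partial>lborel) = - (\<integral>x. g x * \<phi>' n x \<partial>lborel)" for n
  proof -
    have "vector_derivative (\<phi>' n) (at x) = \<psi>' n x" for x
      using der' by (rule vector_derivative_at)
    then show ?thesis
      using wd test[of n] unfolding has_weak_deriv_def by auto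
  qed
  let ?I = "indicator {-R-1..R+1} :: real \<Rightarrow> complex"
  have ind: "?I x = (if \<bar>x\<bar> > R + 1 then 0 else 1)" for x
    by (auto simp: indicator_def)
  have lim1: "(\<lambda>n. \<integral>x. v x * \<psi>' n x \<partial>lborel) \<longlonglongrightarrow> (\<integral>x. v x * \<psi> x \<partial>lborel)"
  proof (rule integral_dominated_convergence)
    show "integrable lborel (\<lambda>x. L * cmod (v x * ?I x))"
      by (intro integrable_mult_right integrable_norm Lp2_product_integrable v Lp2_indicator)
    have "AE x in lborel. x \<notin> S"
      using fin by (intro AE_not_in finite_imp_null_set_lborel)
    then show "AE x in lborel. (\<lambda>n. v x * \<psi>' n x) \<longlonglongrightarrow> v x * \<psi> x"
    proof eventually_elim
      case (elim x)
      have "((\<lambda>k. norm (\<phi> (x + k) - \<phi> x - k *\<^sub>R \<psi> x) / norm k) \<longlongrightarrow> 0) (at 0)"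
        using der[OF elim] by (simp add: has_vector_derivative_def has_derivative_at)
      moreover have "filterlim h (at 0) sequentially"
        using h0 h(1) by (auto simp: filterlim_at less_imp_neq[symmetric])
      ultimately have "(\<lambda>n. norm (\<phi> (x + h n) - \<phi> x - h n *\<^sub>R \<psi> x) / norm (h n)) \<longlonglongrightarrow> 0"
        by (rule filterlim_compose)
      moreover have "norm (\<phi> (x + h n) - \<phi> x - h n *\<^sub>R \<psi> x) / norm (h n) = norm (\<psi>' n x - \<psi> x)" for n
      proof -
        have "\<psi>' n x - \<psi> x = (1 / h n) *\<^sub>R (\<phi> (x + h n) - \<phi> x - h n *\<^sub>R \<psi> x)"
          using h(1)[of n] by (simp add: \<psi>'_def algebra_simps)
        then show ?thesis
          by simp
      qed
      ultimately have "(\<lambda>n. \<psi>' n x - \<psi> x) \<longlonglongrightarrow> 0"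
        by (simp add: tendsto_norm_zero_iff)
      then show ?case
        by (intro tendsto_intros) (simp add: LIM_zero_iff)
    qed
    have "cmod (\<psi>' n x) \<le> L" for n x
      using lipD[of "x + h n" x] h(1)[of n]
      by (simp add: \<psi>'_def pos_divide_le_eq del: scaleR_right_diff_distrib)
    then have "cmod (v x * \<psi>' n x) \<le> L * cmod (v x * ?I x)" for n x
      using supp'(2)[of x n] L
      by (auto simp: ind norm_mult mult.commute[of L] intro!: mult_left_mono)
    then show "AE x in lborel. cmod (v x * \<psi>' n x) \<le> L * cmod (v x * ?I x)" for n
      by simp
  qed measurable
  have lim2: "(\<lambda>n. \<integral>x. g x * \<phi>' n x \<partial>lborel) \<longlonglongrightarrow> (\<integral>x. g x * \<phi> x \<partial>lborel)"
  proof (rule integral_dominated_convergence)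
    \<comment> \<open>The first summand bounds \<phi> through its Lipschitz distance to the zero at
      \<open>\<bar>R\<bar> + 1\<close>; the second pays for the distance between \<phi> and its
      average. The absolute value covers a negative \<open>R\<close>.\<close>
    let ?B = "L * (2 * \<bar>R\<bar> + 1) + L"
    show "integrable lborel (\<lambda>x. ?B * cmod (g x * ?I x))"
      by (intro integrable_mult_right integrable_norm Lp2_product_integrable g Lp2_indicator)
    have "(\<lambda>n. \<phi>' n x - \<phi> x) \<longlonglongrightarrow> 0" for x
      by (rule Lim_null_comparison[OF _ tendsto_mult_right_zero[OF h0, of L]]) (simp add: near1)
    then have "(\<lambda>n. \<phi>' n x) \<longlonglongrightarrow> \<phi> x" for x
      by (simp add: LIM_zero_iff)
    then show "AE x in lborel. (\<lambda>n. g x * \<phi>' n x) \<longlonglongrightarrow> g x * \<phi> x"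
      by (auto intro!: tendsto_intros)
    have "cmod (\<phi> x) \<le> L * (2 * \<bar>R\<bar> + 1)" for x
    proof (cases "\<bar>x\<bar> > R")
      case True
      then show ?thesis using supp[of x] L by simp
    next
      case False
      then have "\<bar>x - (\<bar>R\<bar> + 1)\<bar> \<le> 2 * \<bar>R\<bar> + 1"
        by auto
      then have "L * \<bar>x - (\<bar>R\<bar> + 1)\<bar> \<le> L * (2 * \<bar>R\<bar> + 1)"
        using L by (rule mult_left_mono)
      moreover have "\<phi> (\<bar>R\<bar> + 1) = 0"
        by (rule supp) auto
      ultimately show ?thesis
        using lipD[of x "\<bar>R\<bar> + 1"] by simp
    qed
    moreover have "L * h n \<le> L" for n
      using h(2)[of n] L by (simp add: mult_left_le)
    ultimately have B: "cmod (\<phi>' n x) \<le> ?B" for n x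
      using near1[of n x] norm_triangle_ineq2[of "\<phi>' n x" "\<phi> x"] by (smt (verit))
    then have "cmod (g x * \<phi>' n x) \<le> ?B * cmod (g x * ?I x)" for n x
      using supp'(1)[of x n] L
      by (auto simp: ind norm_mult mult.commute[of ?B] intro!: mult_left_mono)
    then show "AE x in lborel. cmod (g x * \<phi>' n x) \<le> ?B * cmod (g x * ?I x)" for n
      by simp
  qed measurable
  have "(\<lambda>n. - (\<integral>x. g x * \<phi>' n x \<partial>lborel)) \<longlonglongrightarrow> (\<integral>x. v x * \<psi> x \<partial>lborel)"
    using lim1 by (simp add: eq)
  with tendsto_minus[OF lim2] show ?thesis
    by (intro LIMSEQ_unique)
qed

section \<open>Piecewise linear cutoffs and uniqueness of weak derivatives\<close>

definition trapezoid :: "real \<Rightarrow> real \<Rightarrow> real \<Rightarrow> real \<Rightarrow> real" where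
  "trapezoid m a b x = max 0 (min 1 (m * min (x - a) (b - x)))"

text \<open>For \<open>a < b\<close>, \<open>min (x - a) (b - x)\<close> is the signed distance from
  \<open>x\<close> to the complement of the interval, and the trapezoid clips \<open>m\<close> times
  it to \<open>[0, 1]\<close>. The slope is total, with conventional values at the corners, so that
  it is measurable and bounded by \<open>m\<close> everywhere.\<close>

definition trapezoid_slope :: "real \<Rightarrow> real \<Rightarrow> real \<Rightarrow> real \<Rightarrow> real" where
  "trapezoid_slope m a b x =
     (if m * min (x - a) (b - x) \<le> 0 \<or> m * min (x - a) (b - x) \<ge> 1 then 0
      else if x - a < b - x then m else - m)"

lemma trapezoid_bounds: "0 \<le> trapezoid m a b x" "trapezoid m a b x \<le> 1"
  by (auto simp: trapezoid_def)

lemma trapezoid_slope_bound: "m > 0 \<Longrightarrow> \<bar>trapezoid_slope m a b x\<bar> \<le> m"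
  by (auto simp: trapezoid_slope_def)

lemma trapezoid_outside: "m > 0 \<Longrightarrow> \<not> (a < x \<and> x < b) \<Longrightarrow> trapezoid m a b x = 0"
  using mult_nonneg_nonpos[of m "min (x - a) (b - x)"] unfolding trapezoid_def by linarith

lemma trapezoid_Lipschitz:
  assumes "m > 0"
  shows "\<bar>trapezoid m a b x - trapezoid m a b y\<bar> \<le> m * \<bar>x - y\<bar>"
proof -
  have clip: "\<bar>max 0 (min 1 p) - max 0 (min 1 q)\<bar> \<le> \<bar>p - q\<bar>" for p q :: real
    by linarith
  have "\<bar>trapezoid m a b x - trapezoid m a b y\<bar>
      \<le> \<bar>m * min (x - a) (b - x) - m * min (y - a) (b - y)\<bar>"
    unfolding trapezoid_def by (rule clip)
  also have "\<dots> = m * \<bar>min (x - a) (b - x) - min (y - a) (b - y)\<bar>"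
    using assms by (simp add: abs_mult flip: right_diff_distrib)
  also have "\<dots> \<le> m * \<bar>x - y\<bar>"
    using assms by (intro mult_left_mono) auto
  finally show ?thesis .
qed

lemma trapezoid_slope_measurable [measurable]:
  "trapezoid_slope m a b \<in> borel_measurable borel"
  unfolding trapezoid_slope_def [abs_def] by measurable

text \<open>The excluded points are the feet of the two ramps, their tops, and the midpoint; the
  last is a corner when the interval is too short for a plateau. Off them the clipped quantity is
  neither 0 nor 1, and \<open>x\<close> lies in one of four open regions on which the trapezoid is
  affine.\<close>

lemma trapezoid_deriv:
  assumes m: "m > 0" and x: "x \<notin> {a, b, a + 1/m, b - 1/m, (a + b) / 2}"
  shows "(trapezoid m a b has_vector_derivative trapezoid_slope m a b x) (at x)"
proof -
  have out: "m * min (y - a) (b - y) < 0 \<longleftrightarrow> y < a \<or> b < y" for y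
    using m by (auto simp: mult_less_0_iff)
  have lt1: "m * min (y - a) (b - y) < 1 \<longleftrightarrow> y < a + 1/m \<or> b - 1/m < y" for y
    using pos_less_divide_eq[OF m, of "min (y - a) (b - y)" 1] by (auto simp: min_less_iff_disj mult.commute)
  have gt1: "m * min (y - a) (b - y) > 1 \<longleftrightarrow> y > a + 1/m \<and> b - 1/m > y" for y
    using pos_divide_less_eq[OF m, of 1 "min (y - a) (b - y)"] by (auto simp: mult.commute)
  have ins: "m * min (y - a) (b - y) > 0 \<longleftrightarrow> a < y \<and> y < b" for y
    using m by (auto simp: zero_less_mult_iff)
  let ?q = "m * min (x - a) (b - x)"
  consider "?q < 0" | "?q > 1" | "0 < ?q" "?q < 1" "x < (a + b) / 2" | "0 < ?q" "?q < 1" "x > (a + b) / 2"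
    using x m by (smt (verit) insertCI out lt1 gt1 ins)
  then show ?thesis
  proof cases
    case 1
    have "((\<lambda>_. 0) has_vector_derivative 0) (at x)"
      by simp
    then have "(trapezoid m a b has_vector_derivative 0) (at x)"
    proof (rule has_vector_derivative_transform_within_open[where S = "{..<a} \<union> {b<..}"])
      fix y assume "y \<in> {..<a} \<union> {b<..}"
      then have "m * min (y - a) (b - y) < 0"
        by (simp add: out)
      then show "0 = trapezoid m a b y"
        unfolding trapezoid_def by linarith
    qed (use 1 out in auto)
    then show ?thesis
      using 1 by (simp add: trapezoid_slope_def)
  next
    case 2
    have "((\<lambda>_. 1) has_vector_derivative 0) (at x)"
      by simp
    then have "(trapezoid m a b has_vector_derivative 0) (at x)"
    proof (rule has_vector_derivative_transform_within_open[where S = "{a + 1/m<..<b - 1/m}"])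
      fix y assume "y \<in> {a + 1/m<..<b - 1/m}"
      then have "m * min (y - a) (b - y) > 1"
        by (simp add: gt1)
      then show "1 = trapezoid m a b y"
        unfolding trapezoid_def by linarith
    qed (use 2 gt1 in auto)
    then show ?thesis
      using 2 by (simp add: trapezoid_slope_def)
  next
    case 3
    have "((\<lambda>y. m * (y - a)) has_vector_derivative m) (at x)"
      by (auto intro!: derivative_eq_intros simp flip: has_real_derivative_iff_has_vector_derivative)
    then have "(trapezoid m a b has_vector_derivative m) (at x)"
    proof (rule has_vector_derivative_transform_within_open[where
          S = "{a<..<b} \<inter> ({..<a + 1/m} \<union> {b - 1/m<..}) \<inter> {..<(a + b) / 2}"])
      fix y assume y: "y \<in> {a<..<b} \<inter> ({..<a + 1/m} \<union> {b - 1/m<..}) \<inter> {..<(a + b) / 2}"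
      then have "m * min (y - a) (b - y) < 1" "m * min (y - a) (b - y) > 0" "min (y - a) (b - y) = y - a"
        using ins[of y] lt1[of y] by auto
      then show "m * (y - a) = trapezoid m a b y"
        unfolding trapezoid_def by auto
    qed (use 3 lt1 ins in \<open>auto intro!: open_Int open_Un\<close>)
    then show ?thesis
      using 3 by (auto simp: trapezoid_slope_def)
  next
    case 4
    have "((\<lambda>y. m * (b - y)) has_vector_derivative - m) (at x)"
      by (auto intro!: derivative_eq_intros simp flip: has_real_derivative_iff_has_vector_derivative)
    then have "(trapezoid m a b has_vector_derivative - m) (at x)"
    proof (rule has_vector_derivative_transform_within_open[where
          S = "{a<..<b} \<inter> ({..<a + 1/m} \<union> {b - 1/m<..}) \<inter> {(a + b) / 2<..}"])
      fix y assume y: "y \<in> {a<..<b} \<inter> ({..<a + 1/m} \<union> {b - 1/m<..}) \<inter> {(a + b) / 2<..}"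
      then have "m * min (y - a) (b - y) < 1" "m * min (y - a) (b - y) > 0" "min (y - a) (b - y) = b - y"
        using ins[of y] lt1[of y] by auto
      then show "m * (b - y) = trapezoid m a b y"
        unfolding trapezoid_def by auto
    qed (use 4 lt1 ins in \<open>auto intro!: open_Int open_Un\<close>)
    then show ?thesis
      using 4 by (auto simp: trapezoid_slope_def)
  qed
qed

text \<open>Trapezoids of slope \<open>n + 1\<close> are admissible Lipschitz tests and tend to the
  indicator of the open interval; adding \<open>b\<close> costs only a null set. The half-open form
  is chosen because such intervals are closed under intersection and generate the Borel
  sets.\<close>

lemma integral_test_zero_imp_Ioc:
  assumes D: "D \<in> Lp 2" and wd: "has_weak_deriv (\<lambda>_. 0) D"
  shows "(\<integral>x. D x * indicator {a<..b} x \<partial>lborel) = 0"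
proof -
  note [measurable] = D
  define t where "t n x = complex_of_real (trapezoid (real (Suc n)) a b x)" for n x
  have zero: "(\<integral>x. D x * t n x \<partial>lborel) = 0" for n
  proof -
    have "(\<integral>x. 0 * complex_of_real (trapezoid_slope (Suc n) a b x) \<partial>lborel) = - (\<integral>x. D x * t n x \<partial>lborel)"
    proof (rule weak_deriv_test_Lipschitz[OF _ D wd,
          where L = "Suc n" and R = "\<bar>a\<bar> + \<bar>b\<bar>" and S = "{a, b, a + 1/Suc n, b - 1/Suc n, (a + b) / 2}"])
      show "(\<lambda>_. 0) \<in> Lp 2"
        by (simp add: Lp2_iff)
      show "(Suc n)-lipschitz_on UNIV (t n)"
        using trapezoid_Lipschitz[of "Suc n" a b]
        by (intro lipschitz_onI) (auto simp: t_def dist_norm simp flip: of_real_diff)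
      show "t n x = 0" if "\<bar>x\<bar> > \<bar>a\<bar> + \<bar>b\<bar>" for x
        using that unfolding t_def by (subst trapezoid_outside) auto
      show "(t n has_vector_derivative complex_of_real (trapezoid_slope (Suc n) a b x)) (at x)"
        if "x \<notin> {a, b, a + 1/Suc n, b - 1/Suc n, (a + b) / 2}" for x
        unfolding t_def
        by (rule bounded_linear.has_vector_derivative[OF bounded_linear_of_real])
          (rule trapezoid_deriv, use that in auto)
    qed auto
    then show ?thesis
      by simp
  qed
  have [measurable]: "t n \<in> borel_measurable borel" for n
    unfolding t_def trapezoid_def by measurable
  have "(\<lambda>n. \<integral>x. D x * t n x \<partial>lborel) \<longlonglongrightarrow> (\<integral>x. D x * indicator {a<..b} x \<partial>lborel)"
  proof (rule integral_dominated_convergence)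
    show "integrable lborel (\<lambda>x. cmod (D x * indicator {a..b} x))"
      by (intro integrable_norm Lp2_product_integrable D Lp2_indicator)
    have "AE x in lborel. x \<noteq> b"
      by (rule AE_lborel_singleton)
    then show "AE x in lborel. (\<lambda>n. D x * t n x) \<longlonglongrightarrow> D x * indicator {a<..b} x"
    proof eventually_elim
      case (elim x)
      show ?case
      proof (cases "a < x \<and> x < b")
        case True
        let ?d = "min (x - a) (b - x)"
        have d: "?d > 0"
          using True by simp
        obtain N where N: "1 / ?d < real N"
          using reals_Archimedean2 by blast
        have "D x * t n x = D x * indicator {a<..b} x" if "n \<ge> N" for n
        proof -
          have "1 \<le> real (Suc n) * ?d"
            using N d that by (simp add: pos_divide_less_eq) (smt (verit) mult_right_mono of_nat_le_iff)
          then show ?thesis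
            using True by (auto simp: t_def trapezoid_def)
        qed
        then show ?thesis
          by (intro tendsto_eventually eventually_sequentiallyI)
      next
        case False
        then show ?thesis
          using elim by (auto simp: t_def trapezoid_outside)
      qed
    qed
    have "cmod (D x * t n x) \<le> cmod (D x * indicator {a..b} x)" for n x
      using trapezoid_bounds[of "Suc n" a b x] trapezoid_outside[of "Suc n" a x b]
      by (cases "a < x \<and> x < b") (auto simp: t_def norm_mult mult_left_le)
    then show "AE x in lborel. cmod (D x * t n x) \<le> cmod (D x * indicator {a..b} x)" for n
      by simp
  qed measurable
  then show ?thesis
    by (simp add: zero LIMSEQ_const_iff)
qed

text \<open>A pi-lambda argument carries the vanishing of the integral from half-open intervals to
  all Borel sets. The total integral is a separate assumption since complements require it and the
  line is not a bounded interval.\<close>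

lemma AE_zero_if_Ioc_integrals_zero:
  fixes f :: "real \<Rightarrow> complex"
  assumes f: "integrable lborel f" and total: "(\<integral>x. f x \<partial>lborel) = 0"
    and Ioc: "\<And>a b. (\<integral>x. f x * indicator {a<..b} x \<partial>lborel) = 0"
  shows "AE x in lborel. f x = 0"
proof (rule sigma_finite_measure.density_zero[OF sigma_finite_lborel f])
  have int: "set_integrable lborel A f" if "A \<in> sets borel" for A
    unfolding set_integrable_def using f that by (intro integrable_mult_indicator) auto
  fix A assume "A \<in> sets (lborel :: real measure)"
  then have A: "A \<in> sigma_sets UNIV (range (\<lambda>(a, b). {a<..b::real}))"
    by (simp add: borel_sigma_sets_Ioc)
  have stable: "Int_stable (range (\<lambda>(a, b). {a<..b::real}))"
    by (auto simp: Int_stable_def)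
  have "range (\<lambda>(a, b). {a<..b::real}) \<subseteq> Pow UNIV"
    by simp
  from stable this A show "(LINT x:A|lborel. f x) = 0"
  proof (induction A rule: sigma_sets_induct_disjoint)
    case (basic A)
    then show ?case
      using Ioc by (auto simp: set_lebesgue_integral_def scaleR_conv_of_real mult.commute of_real_indicator)
  next
    case empty
    then show ?case
      by (simp add: set_lebesgue_integral_def)
  next
    case (compl A)
    then have A: "A \<in> sets borel"
      by (simp add: borel_sigma_sets_Ioc)
    have "(LINT x:A \<union> (UNIV - A)|lborel. f x) = (LINT x:A|lborel. f x) + (LINT x:UNIV - A|lborel. f x)"
      using A by (intro set_integral_Un int) auto
    then show ?case
      using compl total by (simp add: set_lebesgue_integral_def)
  next
    case (union A)
    then have A: "A i \<in> sets borel" for i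
      by (auto simp: borel_sigma_sets_Ioc)
    have "(LINT x:(\<Union>i. A i)|lborel. f x) = (\<Sum>i. LINT x:A i|lborel. f x)"
      using A union(1) by (intro lebesgue_integral_countable_add int) (auto simp: disjoint_family_on_def)
    then show ?case
      using union by simp
  qed
qed

text \<open>The du Bois-Reymond lemma in the form needed here. A function in \<open>Lp 2\<close>
  need not be integrable, so the measure argument is applied to its truncations to
  \<open>(-n, n]\<close>, which turn an interval integral into another interval integral.\<close>

lemma weak_deriv_zero_AE:
  assumes D: "D \<in> Lp 2" and wd: "has_weak_deriv (\<lambda>_. 0) D"
  shows "AE x in lborel. D x = 0"
proof -
  have "AE x in lborel. D x * indicator {-real n<..real n} x = 0" for n :: nat
  proof (rule AE_zero_if_Ioc_integrals_zero)
    show "integrable lborel (\<lambda>x. D x * indicator {-real n<..real n} x)"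
    proof (intro Lp2_product_integrable D)
      show "(indicator {-real n<..real n} :: real \<Rightarrow> complex) \<in> Lp 2"
        by (rule Lp2_bounded[OF _ Lp2_indicator[of "-real n" "real n"], of _ 1]) (auto simp: indicator_def)
    qed
    show "(\<integral>x. D x * indicator {-real n<..real n} x * indicator {a<..b} x \<partial>lborel) = 0" for a b
    proof -
      have "(\<lambda>x. D x * indicator {-real n<..real n} x * indicator {a<..b} x) =
          (\<lambda>x. D x * indicator {max a (-real n)<..min b (real n)} x)"
        by (auto simp: indicator_def fun_eq_iff)
      then show ?thesis
        using integral_test_zero_imp_Ioc[OF assms] by simp
    qed
  qed (rule integral_test_zero_imp_Ioc[OF assms])
  then have "AE x in lborel. \<forall>n::nat. D x * indicator {-real n<..real n} x = 0"
    unfolding AE_all_countable by blast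
  then show ?thesis
  proof eventually_elim
    case (elim x)
    obtain n where "\<bar>x\<bar> < real n"
      using reals_Archimedean2 by blast
    with elim[rule_format, of n] show ?case
      by (auto simp: indicator_def split: if_splits)
  qed
qed

lemma continuous_bounded_support_Lp2:
  assumes cont: "continuous_on UNIV \<phi>" and supp: "\<And>x. \<bar>x\<bar> > R \<Longrightarrow> \<phi> x = 0"
  shows "\<phi> \<in> Lp 2"
proof -
  have comp: "compact (\<phi> ` {-R..R})"
    by (intro compact_continuous_image continuous_on_subset[OF cont]) auto
  obtain C where C: "\<And>x. x \<in> {-R..R} \<Longrightarrow> cmod (\<phi> x) \<le> C"
    using compact_imp_bounded[OF comp] unfolding bounded_iff by blast
  have "cmod (\<phi> x) \<le> C * cmod (indicator {-R..R} x)" for x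
    using C[of x] supp[of x] by (auto simp: indicator_def)
  then show ?thesis
    using cont by (intro Lp2_bounded[OF _ Lp2_indicator[of "-R" R], of _ C] borel_measurable_continuous_onI)
qed

lemma test_functionE:
  assumes "\<phi> \<in> test_functions"
  obtains \<psi> R where "\<And>x. (\<phi> has_vector_derivative \<psi> x) (at x)" "continuous_on UNIV \<psi>"
    "\<And>x. \<bar>x\<bar> > R \<Longrightarrow> \<phi> x = 0" "\<And>x. \<bar>x\<bar> > R \<Longrightarrow> \<psi> x = 0" "\<phi> \<in> Lp 2" "\<psi> \<in> Lp 2"
proof -
  obtain \<psi> where \<psi>: "\<And>x. (\<phi> has_vector_derivative \<psi> x) (at x)" "continuous_on UNIV \<psi>"
    using assms by (auto simp: test_functions_def C1_differentiable_on_def)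
  have comp: "compact (closure {x. \<phi> x \<noteq> 0})"
    using assms by (simp add: test_functions_def)
  obtain R where R: "\<And>x. x \<in> closure {x. \<phi> x \<noteq> 0} \<Longrightarrow> \<bar>x\<bar> \<le> R"
    using compact_imp_bounded[OF comp] by (auto simp: bounded_iff)
  have \<phi>0: "\<phi> x = 0" if "\<bar>x\<bar> > R" for x
  proof (rule ccontr)
    assume "\<phi> x \<noteq> 0"
    then have "x \<in> closure {x. \<phi> x \<noteq> 0}"
      by (intro subsetD[OF closure_subset]) simp
    from R[OF this] that show False
      by simp
  qed
  have \<psi>0: "\<psi> x = 0" if x: "\<bar>x\<bar> > R" for x
  proof (rule vector_derivative_unique_at[OF \<psi>(1)])
    have "((\<lambda>_. 0) has_vector_derivative 0) (at x)"
      by simp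
    then show "(\<phi> has_vector_derivative 0) (at x)"
      by (rule has_vector_derivative_transform_within_open[where S = "{..<-R} \<union> {R<..}"])
        (use x \<phi>0 in \<open>auto intro!: open_Un\<close>)
  qed
  have "continuous_on UNIV \<phi>"
    using \<psi>(1) by (meson continuous_at_imp_continuous_on has_vector_derivative_continuous)
  then have "\<phi> \<in> Lp 2"
    using \<phi>0 by (rule continuous_bounded_support_Lp2)
  moreover have "\<psi> \<in> Lp 2"
    using \<psi>(2) \<psi>0 by (rule continuous_bounded_support_Lp2)
  ultimately show ?thesis
    using that[OF \<psi> \<phi>0 \<psi>0] by simp
qed

text \<open>Since \<open>weak_deriv\<close> is an unspecified choice, this is what allows it to be
  replaced by an explicitly computed derivative under the integral of the form.\<close>

lemma weak_deriv_AE_unique: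
  assumes "g \<in> Lp 2" "h \<in> Lp 2" "has_weak_deriv u g" "has_weak_deriv u h"
  shows "AE x in lborel. g x = h x"
proof -
  have "has_weak_deriv (\<lambda>_. 0) (\<lambda>x. g x - h x)"
    unfolding has_weak_deriv_def
  proof
    fix \<phi> assume \<phi>: "\<phi> \<in> test_functions"
    then have "\<phi> \<in> Lp 2"
      by (elim test_functionE)
    have "(\<integral>x. (g x - h x) * \<phi> x \<partial>lborel) = (\<integral>x. g x * \<phi> x \<partial>lborel) - (\<integral>x. h x * \<phi> x \<partial>lborel)"
      using assms \<open>\<phi> \<in> Lp 2\<close>
      by (simp add: left_diff_distrib Bochner_Integration.integral_diff Lp2_product_integrable)
    also have "\<dots> = 0"
      using assms(3,4)[unfolded has_weak_deriv_def, rule_format, OF \<phi>] by simp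
    finally show "(\<integral>x. 0 * vector_derivative \<phi> (at x) \<partial>lborel) = - (\<integral>x. (g x - h x) * \<phi> x \<partial>lborel)"
      by simp
  qed
  then have "AE x in lborel. g x - h x = 0"
    using assms by (intro weak_deriv_zero_AE Lp2_diff)
  then show ?thesis
    by eventually_elim simp
qed

lemma weak_deriv_spec:
  assumes "u \<in> H1"
  shows "weak_deriv u \<in> Lp 2" "has_weak_deriv u (weak_deriv u)"
proof -
  have "\<exists>g. g \<in> Lp 2 \<and> has_weak_deriv u g"
    using assms by (auto simp: H1_def)
  from someI_ex[OF this] show "weak_deriv u \<in> Lp 2" "has_weak_deriv u (weak_deriv u)"
    unfolding weak_deriv_def by blast+
qed

text \<open>Removes the bounded support by multiplying \<phi> with wide cutoffs. Their slopes are at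
  most 1, so the products are Lipschitz with constant \<open>L + B\<close>, and the extra term from
  differentiating the cutoff is dominated by \<open>v x * \<phi> x\<close> and vanishes at each
  point for large \<open>n\<close>. Exponential tails make this step necessary.\<close>

lemma weak_deriv_test:
  fixes \<phi> \<psi> :: "real \<Rightarrow> complex"
  assumes v: "v \<in> Lp 2" and g: "g \<in> Lp 2" and wd: "has_weak_deriv v g"
    and lip: "L-lipschitz_on UNIV \<phi>" and bound: "\<And>x. cmod (\<phi> x) \<le> B"
    and fin: "finite S"
    and der: "\<And>x. x \<notin> S \<Longrightarrow> (\<phi> has_vector_derivative \<psi> x) (at x)"
    and \<phi>: "\<phi> \<in> Lp 2" and \<psi>: "\<psi> \<in> Lp 2"
  shows "(\<integral>x. v x * \<psi> x \<partial>lborel) = - (\<integral>x. g x * \<phi> x \<partial>lborel)"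
proof -
  note [measurable] = v g \<phi> \<psi>
  have L: "L \<ge> 0"
    using lip by (rule lipschitz_on_nonneg)
  have lipD: "cmod (\<phi> x - \<phi> y) \<le> L * \<bar>x - y\<bar>" for x y
    using lipschitz_onD[OF lip, of x y] by (simp add: dist_norm)
  \<comment> \<open>With ramps of slope 1, the extra 1 makes the plateau exactly
    \<open>[-n, n]\<close>.\<close>
  define a where "a n = real n + 1" for n
  define t where "t n x = trapezoid 1 (- a n) (a n) x" for n x
  define t' where "t' n x = trapezoid_slope 1 (- a n) (a n) x" for n x
  have t01: "0 \<le> t n x" "t n x \<le> 1" "\<bar>t' n x\<bar> \<le> 1" for n x
    using trapezoid_bounds[of 1 "- a n" "a n"] trapezoid_slope_bound[of 1 "- a n" "a n"]
    by (auto simp: t_def t'_def)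
  have [measurable]: "t n \<in> borel_measurable borel" "t' n \<in> borel_measurable borel" for n
    unfolding t_def trapezoid_def t'_def by measurable
  have inner: "t n x = 1" "t' n x = 0" if "\<bar>x\<bar> \<le> real n" for n x
    using that by (auto simp: t_def t'_def trapezoid_def trapezoid_slope_def a_def)
  define \<phi>' where "\<phi>' n x = t n x *\<^sub>R \<phi> x" for n x
  define \<psi>' where "\<psi>' n x = t n x *\<^sub>R \<psi> x + t' n x *\<^sub>R \<phi> x" for n x
  have eq: "(\<integral>x. v x * \<psi>' n x \<partial>lborel) = - (\<integral>x. g x * \<phi>' n x \<partial>lborel)" for n
  proof (rule weak_deriv_test_Lipschitz[OF v g wd, where L = "L + B" and R = "a n"
        and S = "S \<union> {- a n, a n, - a n + 1/1, a n - 1/1, (- a n + a n) / 2}"])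
    show "(L + B)-lipschitz_on UNIV (\<phi>' n)"
    proof (rule lipschitz_onI)
      fix x y
      have "cmod (\<phi>' n x - \<phi>' n y) = cmod (t n x *\<^sub>R (\<phi> x - \<phi> y) + (t n x - t n y) *\<^sub>R \<phi> y)"
        by (simp add: \<phi>'_def algebra_simps)
      also have "\<dots> \<le> t n x * cmod (\<phi> x - \<phi> y) + \<bar>t n x - t n y\<bar> * cmod (\<phi> y)"
        using t01[of n x] by (intro order_trans[OF norm_triangle_ineq]) simp
      also have "\<dots> \<le> 1 * (L * \<bar>x - y\<bar>) + (1 * \<bar>x - y\<bar>) * B"
        using t01[of n x] lipD bound trapezoid_Lipschitz[of 1 "- a n" "a n" x y] L unfolding t_def
        by (intro add_mono mult_mono) auto
      finally show "dist (\<phi>' n x) (\<phi>' n y) \<le> (L + B) * dist x y"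
        by (simp add: dist_norm algebra_simps)
      show "0 \<le> L + B"
        using L order_trans[OF norm_ge_zero bound[of 0]] by simp
    qed
    show "\<phi>' n x = 0" if "\<bar>x\<bar> > a n" for x
      using that unfolding \<phi>'_def t_def by (subst trapezoid_outside) auto
    show "(\<phi>' n has_vector_derivative \<psi>' n x) (at x)"
      if "x \<notin> S \<union> {- a n, a n, - a n + 1/1, a n - 1/1, (- a n + a n) / 2}" for x
    proof -
      have "(t n has_vector_derivative t' n x) (at x)"
        unfolding t_def t'_def by (rule trapezoid_deriv) (use that in auto)
      then show ?thesis
        unfolding \<phi>'_def \<psi>'_def
        using der[of x] that by (intro has_vector_derivative_scaleR) (auto simp: has_real_derivative_iff_has_vector_derivative)
    qed
    show "\<psi>' n \<in> borel_measurable borel"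
      unfolding \<psi>'_def by measurable
  qed (use fin in auto)
  have ev: "\<forall>\<^sub>F n in sequentially. \<bar>x\<bar> \<le> real n" for x
    by (rule eventually_sequentiallyI[of "nat \<lceil>\<bar>x\<bar>\<rceil>"]) linarith
  have lim1: "(\<lambda>n. \<integral>x. v x * \<psi>' n x \<partial>lborel) \<longlonglongrightarrow> (\<integral>x. v x * \<psi> x \<partial>lborel)"
  proof (rule integral_dominated_convergence)
    show "integrable lborel (\<lambda>x. cmod (v x * \<psi> x) + cmod (v x * \<phi> x))"
      using v \<phi> \<psi> by (intro Bochner_Integration.integrable_add integrable_norm Lp2_product_integrable)
    have "\<forall>\<^sub>F n in sequentially. v x * \<psi>' n x = v x * \<psi> x" for x
      using ev[of x] by eventually_elim (simp add: \<psi>'_def inner)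
    then show "AE x in lborel. (\<lambda>n. v x * \<psi>' n x) \<longlonglongrightarrow> v x * \<psi> x"
      by (auto intro!: tendsto_eventually)
    have "cmod (v x * \<psi>' n x) \<le> cmod (v x * \<psi> x) + cmod (v x * \<phi> x)" for n x
    proof -
      have "cmod (\<psi>' n x) \<le> \<bar>t n x\<bar> * cmod (\<psi> x) + \<bar>t' n x\<bar> * cmod (\<phi> x)"
        unfolding \<psi>'_def by (intro order_trans[OF norm_triangle_ineq]) simp
      also have "\<dots> \<le> 1 * cmod (\<psi> x) + 1 * cmod (\<phi> x)"
        using t01[of n x] by (intro add_mono mult_right_mono) auto
      finally have "cmod (v x) * cmod (\<psi>' n x) \<le> cmod (v x) * (cmod (\<psi> x) + cmod (\<phi> x))"
        by (intro mult_left_mono) auto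
      then show ?thesis
        by (simp add: norm_mult distrib_left)
    qed
    then show "AE x in lborel. cmod (v x * \<psi>' n x) \<le> cmod (v x * \<psi> x) + cmod (v x * \<phi> x)" for n
      by simp
  qed (simp_all add: \<psi>'_def)
  have lim2: "(\<lambda>n. \<integral>x. g x * \<phi>' n x \<partial>lborel) \<longlonglongrightarrow> (\<integral>x. g x * \<phi> x \<partial>lborel)"
  proof (rule integral_dominated_convergence)
    show "integrable lborel (\<lambda>x. cmod (g x * \<phi> x))"
      using g \<phi> by (intro integrable_norm Lp2_product_integrable)
    have "\<forall>\<^sub>F n in sequentially. g x * \<phi>' n x = g x * \<phi> x" for x
      using ev[of x] by eventually_elim (simp add: \<phi>'_def inner)
    then show "AE x in lborel. (\<lambda>n. g x * \<phi>' n x) \<longlonglongrightarrow> g x * \<phi> x"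
      by (auto intro!: tendsto_eventually)
    have "cmod (g x * \<phi>' n x) \<le> cmod (g x * \<phi> x)" for n x
    proof -
      have "t n x * (cmod (g x) * cmod (\<phi> x)) \<le> 1 * (cmod (g x) * cmod (\<phi> x))"
        using t01 by (intro mult_right_mono) auto
      then show ?thesis
        using t01[of n x] by (simp add: \<phi>'_def norm_mult mult_ac)
    qed
    then show "AE x in lborel. cmod (g x * \<phi>' n x) \<le> cmod (g x * \<phi> x)" for n
      by simp
  qed (simp_all add: \<phi>'_def)
  have "(\<lambda>n. - (\<integral>x. g x * \<phi>' n x \<partial>lborel)) \<longlonglongrightarrow> (\<integral>x. v x * \<psi> x \<partial>lborel)"
    using lim1 by (simp add: eq)
  with tendsto_minus[OF lim2] show ?thesis
    by (intro LIMSEQ_unique)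
qed

section \<open>Eigenvalues of square wells\<close>

text \<open>Integration by parts: the fundamental theorem of calculus, which tolerates finitely many
  exceptional points for a continuous function, is applied to the product of \<open>u\<close> and
  the test function on an interval whose endpoints lie outside the support.\<close>

lemma classical_imp_weak_deriv:
  assumes u: "u \<in> Lp 2" and g: "g \<in> Lp 2" and cont: "continuous_on UNIV u" and fin: "finite S"
    and der: "\<And>x. x \<notin> S \<Longrightarrow> (u has_vector_derivative g x) (at x)"
  shows "has_weak_deriv u g"
  unfolding has_weak_deriv_def
proof
  fix \<phi> assume "\<phi> \<in> test_functions"
  then obtain \<psi> R where \<psi>: "\<And>x. (\<phi> has_vector_derivative \<psi> x) (at x)"
    and "continuous_on UNIV \<psi>"
    and supp: "\<And>x. \<bar>x\<bar> > R \<Longrightarrow> \<phi> x = 0" "\<And>x. \<bar>x\<bar> > R \<Longrightarrow> \<psi> x = 0"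
    and L2: "\<phi> \<in> Lp 2" "\<psi> \<in> Lp 2"
    by (elim test_functionE) blast
  have cont\<phi>: "continuous_on UNIV \<phi>"
    using \<psi> by (meson continuous_at_imp_continuous_on has_vector_derivative_continuous)
  define A where "A = \<bar>R\<bar> + 1"
  let ?f = "\<lambda>x. u x * \<psi> x + g x * \<phi> x"
  have int: "integrable lborel (\<lambda>x. u x * \<psi> x)" "integrable lborel (\<lambda>x. g x * \<phi> x)"
    using u g L2 by (auto intro: Lp2_product_integrable)
  have "(?f has_integral (u A * \<phi> A - u (-A) * \<phi> (-A))) {-A..A}"
  proof (rule fundamental_theorem_of_calculus_interior_strong[OF fin])
    show "((\<lambda>x. u x * \<phi> x) has_vector_derivative ?f x) (at x)" if "x \<in> {-A<..<A} - S" for x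
      using that by (intro has_vector_derivative_mult der \<psi>) auto
    show "continuous_on {-A..A} (\<lambda>x. u x * \<phi> x)"
      by (intro continuous_intros continuous_on_subset[OF cont] continuous_on_subset[OF cont\<phi>]) auto
  qed (auto simp: A_def)
  moreover have "\<phi> A = 0" "\<phi> (-A) = 0"
    by (auto simp: A_def intro!: supp)
  ultimately have "integral {-A..A} ?f = 0"
    by (simp add: integral_unique)
  moreover have "(LINT x:{-A..A}|lborel. ?f x) = integral {-A..A} ?f"
    by (intro set_borel_integral_eq_integral(2))
      (auto simp: set_integrable_def intro!: integrable_mult_indicator Bochner_Integration.integrable_add int)
  moreover have "(LINT x:{-A..A}|lborel. ?f x) = (\<integral>x. ?f x \<partial>lborel)"
    unfolding set_lebesgue_integral_def
    by (rule Bochner_Integration.integral_cong) (auto simp: indicator_def A_def supp)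
  ultimately have "(\<integral>x. u x * \<psi> x \<partial>lborel) + (\<integral>x. g x * \<phi> x \<partial>lborel) = 0"
    using int by (simp add: Bochner_Integration.integral_add)
  moreover have "vector_derivative \<phi> (at x) = \<psi> x" for x
    using \<psi> by (rule vector_derivative_at)
  ultimately show "(\<integral>x. u x * vector_derivative \<phi> (at x) \<partial>lborel) = - (\<integral>x. g x * \<phi> x \<partial>lborel)"
    by (simp add: eq_neg_iff_add_eq_0)
qed

lemma Lipschitz_if_deriv_bounded:
  fixes f :: "real \<Rightarrow> 'a::banach"
  assumes cont: "continuous_on UNIV f" and fin: "finite S" and "L \<ge> 0"
    and der: "\<And>x. x \<notin> S \<Longrightarrow> (f has_vector_derivative f' x) (at x)"
    and bound: "\<And>x. norm (f' x) \<le> L"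
  shows "L-lipschitz_on UNIV f"
proof (rule lipschitz_on_leI)
  fix x y :: real assume "x \<le> y"
  have "(f' has_integral (f y - f x)) {x..y}"
    using fin \<open>x \<le> y\<close> by (rule fundamental_theorem_of_calculus_interior_strong)
      (auto intro: der continuous_on_subset[OF cont])
  then have "norm (f y - f x) \<le> L * (y - x)"
    using has_integral_bound[where f = f' and a = x and b = y and B = L and i = "f y - f x"] bound \<open>L \<ge> 0\<close> \<open>x \<le> y\<close>
    by (simp add: cbox_interval)
  then show "dist (f x) (f y) \<le> L * dist x y"
    using \<open>x \<le> y\<close> by (simp add: dist_norm norm_minus_commute)
qed fact

lemma integrable_exp_neg_abs:
  assumes b: "b > 0"
  shows "integrable lborel (\<lambda>x::real. exp (- b * \<bar>x\<bar>))"
proof -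
  have half: "integrable lborel (\<lambda>x::real. exp (- b * x) * indicator {0..} x)"
  proof (rule integrableI_nn_integral_finite)
    have "(\<integral>\<^sup>+ x. ennreal (exp (- b * x)) * indicator {0..} x \<partial>lborel) = ennreal (0 - (- exp (- b * 0) / b))"
    proof (rule nn_integral_FTC_atLeast)
      show "DERIV (\<lambda>x. - exp (- b * x) / b) x :> exp (- b * x)" for x
        using b by (auto intro!: derivative_eq_intros)
      show "((\<lambda>x. - exp (- b * x) / b) \<longlongrightarrow> 0) at_top"
        using b by real_asymp
    qed auto
    then show "(\<integral>\<^sup>+ x. ennreal (exp (- b * x) * indicator {0..} x) \<partial>lborel) = ennreal (1 / b)"
      by (simp add: ennreal_mult' ennreal_indicator)
  qed auto
  have "integrable lborel (\<lambda>x. exp (- b * (0 + (-1) * x)) * indicator {0..} (0 + (-1) * x))"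
    using half by (rule lborel_integrable_real_affine) simp
  from Bochner_Integration.integrable_add[OF half this] show ?thesis
    by (rule Bochner_Integration.integrable_bound) (auto simp: indicator_def)
qed

lemma continuous_not_AE_zero:
  fixes f :: "real \<Rightarrow> complex"
  assumes cont: "continuous_on UNIV f" and "f a \<noteq> 0"
  shows "\<not> (AE x in lborel. f x = 0)"
proof
  assume ae: "AE x in lborel. f x = 0"
  have "isCont f a"
    using cont by (simp add: continuous_on_eq_continuous_at)
  then obtain e where e: "e > 0" "\<And>x. dist a x < e \<Longrightarrow> f x \<noteq> 0"
    using continuous_at_avoid[of a f 0] assms(2) by blast
  have "AE x in lborel. x \<notin> {a<..<a+e}"
    using ae by eventually_elim (use e in \<open>auto simp: dist_real_def\<close>)
  then have "{a<..<a+e} \<in> null_sets lborel"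
    by (subst AE_iff_null_sets) auto
  then show False
    using e(1) by (auto simp: null_sets_def)
qed

text \<open>An eigenfunction violates the bounded-inverse clause: the right-hand norm is 0, so
  \<open>u\<close> would vanish almost everywhere, which continuity and one nonzero value
  exclude.\<close>

lemma eigenvalue_in_spectrum:
  assumes "(u, \<lambda>x. z * u x) \<in> A" "u \<in> Lp 2" "continuous_on UNIV u" "u a \<noteq> 0"
  shows "z \<in> spectrum A"
proof -
  have False if z: "z \<in> resolvent_set A"
  proof -
    obtain C where "\<forall>(u, g)\<in>A. Lp_norm 2 u \<le> C * Lp_norm 2 (\<lambda>x. g x - z * u x)"
      using z unfolding resolvent_set_def by blast
    from bspec[OF this assms(1)] have "Lp_norm 2 u \<le> C * Lp_norm 2 (\<lambda>x. z * u x - z * u x)"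
      by simp
    then have "Lp_norm 2 u \<le> 0"
      by (simp add: Lp_norm_def)
    then have "(\<integral>x. (cmod (u x))\<^sup>2 \<partial>lborel) = 0"
      using powr_ge_zero by (simp add: Lp_norm_def)
    then have "AE x in lborel. (cmod (u x))\<^sup>2 = 0"
      using assms(2) by (subst (asm) integral_nonneg_eq_0_iff_AE) (auto simp: Lp2_iff)
    then have "AE x in lborel. u x = 0"
      by simp
    then show False
      using continuous_not_AE_zero assms(3,4) by blast
  qed
  then show ?thesis
    by (auto simp: spectrum_def)
qed

text \<open>For \<open>v\<close> in \<open>H1\<close> the gradient term is integrated by parts by
  testing the weak derivative of \<open>v\<close> against the conjugate of \<open>du\<close>, which
  is Lipschitz because \<open>d2u\<close> is bounded. The pointwise equation then turns the form
  into the inner product with \<open>z * u\<close>. No second derivative is needed at the points of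
  \<open>S\<close>.\<close>

lemma schroedinger_eigenfunction:
  assumes u: "u \<in> Lp 2" and du: "du \<in> Lp 2" and d2u: "d2u \<in> Lp 2"
    and cont: "continuous_on UNIV u" "continuous_on UNIV du"
    and fin: "finite S"
    and der: "\<And>x. x \<notin> S \<Longrightarrow> (u has_vector_derivative du x) (at x)"
      "\<And>x. x \<notin> S \<Longrightarrow> (du has_vector_derivative d2u x) (at x)"
    and bound: "\<And>x. cmod (du x) \<le> B" "\<And>x. cmod (d2u x) \<le> L"
    and Vu: "\<And>x. V x * u x = d2u x + z * u x"
  shows "(u, \<lambda>x. z * u x) \<in> schroedinger_operator V"
proof -
  have wd: "has_weak_deriv u du"
    using u du cont(1) fin der(1) by (rule classical_imp_weak_deriv)
  have uH1: "u \<in> H1"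
    using u du wd by (auto simp: H1_def)
  have zu: "(\<lambda>x. z * u x) \<in> Lp 2"
    by (rule Lp2_bounded[OF _ u, of _ "cmod z"]) (use u in \<open>auto simp: norm_mult\<close>)
  have "L \<ge> 0"
    using bound(2) norm_ge_zero order_trans by blast
  have lip: "L-lipschitz_on UNIV du"
    using cont(2) fin \<open>L \<ge> 0\<close> der(2) bound(2) by (rule Lipschitz_if_deriv_bounded)
  have meas_cnj: "(\<lambda>x. cnj (f x)) \<in> borel_measurable borel" if "f \<in> Lp 2" for f
    using Lp2_cnj[OF that] by (rule Lp2_measurable)
  have "schroedinger_form V u v = L2_inner (\<lambda>x. z * u x) v" if v: "v \<in> H1" for v
  proof -
    define w where "w = weak_deriv v"
    have w: "w \<in> Lp 2" "has_weak_deriv v w"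
      using weak_deriv_spec[OF v] by (simp_all add: w_def)
    have v2: "v \<in> Lp 2"
      using v by (simp add: H1_def)
    note [measurable] = meas_cnj[OF w(1)] weak_deriv_spec(1)[OF uH1] du
    have "AE x in lborel. weak_deriv u x = du x"
      using weak_deriv_spec[OF uH1] du wd by (intro weak_deriv_AE_unique)
    then have "AE x in lborel. weak_deriv u x * cnj (w x) = du x * cnj (w x)"
      by eventually_elim simp
    then have "(\<integral>x. weak_deriv u x * cnj (w x) \<partial>lborel) = (\<integral>x. du x * cnj (w x) \<partial>lborel)"
      by (intro integral_cong_AE) auto
    also have "\<dots> = cnj (\<integral>x. w x * cnj (du x) \<partial>lborel)"
      by (subst Bochner_Integration.integral_cnj[symmetric]) (simp add: mult.commute)
    also have "(\<integral>x. w x * cnj (du x) \<partial>lborel) = - (\<integral>x. v x * cnj (d2u x) \<partial>lborel)"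
    proof -
      have "(\<integral>x. v x * cnj (d2u x) \<partial>lborel) = - (\<integral>x. w x * cnj (du x) \<partial>lborel)"
      proof (rule weak_deriv_test[OF v2 w, where L = L and S = S and B = B])
        show "L-lipschitz_on UNIV (\<lambda>x. cnj (du x))"
          using lip by (simp add: lipschitz_on_def dist_norm flip: complex_cnj_diff)
        show "((\<lambda>x. cnj (du x)) has_vector_derivative cnj (d2u x)) (at x)" if "x \<notin> S" for x
          using der(2)[OF that] by (rule bounded_linear.has_vector_derivative[OF bounded_linear_cnj])
      qed (use bound fin du d2u in \<open>auto intro: Lp2_cnj\<close>)
      then show ?thesis
        by simp
    qed
    also have "cnj (- (\<integral>x. v x * cnj (d2u x) \<partial>lborel)) = - (\<integral>x. d2u x * cnj (v x) \<partial>lborel)"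
      by (simp add: mult.commute flip: Bochner_Integration.integral_cnj)
    finally have form1: "(\<integral>x. weak_deriv u x * cnj (w x) \<partial>lborel) = - (\<integral>x. d2u x * cnj (v x) \<partial>lborel)" .
    have "(\<integral>x. V x * u x * cnj (v x) \<partial>lborel) = (\<integral>x. d2u x * cnj (v x) + z * u x * cnj (v x) \<partial>lborel)"
      by (simp add: Vu distrib_right)
    also have "\<dots> = (\<integral>x. d2u x * cnj (v x) \<partial>lborel) + (\<integral>x. z * u x * cnj (v x) \<partial>lborel)"
      by (intro Bochner_Integration.integral_add Lp2_product_integrable Lp2_cnj v2 d2u zu)
    finally show ?thesis
      using form1 by (simp add: schroedinger_form_def L2_inner_def w_def)
  qed
  then show ?thesis
    using uH1 zu by (simp add: schroedinger_operator_def form_operator_def)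
qed

text \<open>The odd solution is a sine inside and an exponential outside, decaying because
  \<open>Im k > 0\<close>. The hypothesis \<open>match\<close> is continuity of its derivative at
  the edges, and \<open>energy\<close> makes both pieces solve the equation with the same
  eigenvalue.\<close>

lemma square_well_eigenvalue:
  fixes a :: real and c k \<kappa> :: complex
  assumes a: "a > 0" and k: "Im k > 0" and "\<kappa> \<noteq> 0"
    and match: "\<kappa> * cos (\<kappa> * of_real a) = \<i> * k * sin (\<kappa> * of_real a)"
    and energy: "k\<^sup>2 = \<kappa>\<^sup>2 + c"
  shows "k\<^sup>2 \<in> spectrum (schroedinger_operator (\<lambda>x. c * indicator {-a..a} x))"
proof -
  \<comment> \<open>\<open>q\<close> is the nearest point of the well and \<open>r\<close> the
    distance to it. With them a single formula covers all three pieces, and continuity is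
    immediate.\<close>
  define q where "q x = max (-a) (min a x)" for x
  define r where "r x = max 0 (\<bar>x\<bar> - a)" for x
  define e where "e x = exp (\<i> * k * of_real (r x))" for x
  define u where "u x = sin (\<kappa> * of_real (q x)) * e x" for x
  define du where "du x = \<kappa> * cos (\<kappa> * of_real (q x)) * e x" for x
  \<comment> \<open>The eigenvalue equation holds by this definition; what remains is that
    \<open>d2u\<close> is the derivative of \<open>du\<close> away from the edges.\<close>
  define d2u where "d2u x = (c * indicator {-a..a} x - k\<^sup>2) * u x" for x
  have cont_e: "continuous_on UNIV e"
    unfolding e_def r_def by (intro continuous_intros)
  have cont: "continuous_on UNIV u" "continuous_on UNIV du"
    unfolding u_def du_def e_def r_def q_def by (intro continuous_intros)+
  note [measurable] = borel_measurable_continuous_onI[OF cont_e] cont[THEN borel_measurable_continuous_onI]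
  have norm_e: "cmod (e x) = exp (- Im k * r x)" for x
    by (simp add: e_def)
  have e1: "cmod (e x) \<le> 1" for x
    using k by (simp add: norm_e r_def)
  have e2: "e \<in> Lp 2"
  proof -
    have "integrable lborel (\<lambda>x. exp (2 * Im k * a) * exp (- (2 * Im k) * \<bar>x\<bar>))"
      using k by (intro integrable_mult_right integrable_exp_neg_abs) simp
    then have "integrable lborel (\<lambda>x. (cmod (e x))\<^sup>2)"
    proof (rule Bochner_Integration.integrable_bound)
      have "(cmod (e x))\<^sup>2 \<le> exp (2 * Im k * a) * exp (- (2 * Im k) * \<bar>x\<bar>)" for x
      proof -
        have "Im k * (\<bar>x\<bar> - a) \<le> Im k * r x"
          using k by (intro mult_left_mono) (auto simp: r_def)
        then show ?thesis
          by (simp add: norm_e algebra_simps flip: exp_add exp_of_nat_mult)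
      qed
      then show "AE x in lborel. norm ((cmod (e x))\<^sup>2) \<le> norm (exp (2 * Im k * a) * exp (- (2 * Im k) * \<bar>x\<bar>))"
        by simp
    qed measurable
    then show ?thesis
      by (simp add: Lp2_iff)
  qed
  have comp: "compact ((\<lambda>t. sin (\<kappa> * of_real t)) ` {-a..a})"
    "compact ((\<lambda>t. \<kappa> * cos (\<kappa> * of_real t)) ` {-a..a})"
    by (intro compact_continuous_image continuous_intros compact_Icc)+
  obtain K1 where K1: "\<And>t. t \<in> {-a..a} \<Longrightarrow> cmod (sin (\<kappa> * of_real t)) \<le> K1"
    using compact_imp_bounded[OF comp(1)] unfolding bounded_iff by blast
  obtain K2 where K2: "\<And>t. t \<in> {-a..a} \<Longrightarrow> cmod (\<kappa> * cos (\<kappa> * of_real t)) \<le> K2"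
    using compact_imp_bounded[OF comp(2)] unfolding bounded_iff by blast
  note K = K1 K2
  have q: "q x \<in> {-a..a}" for x
    using a by (auto simp: q_def)
  have ub: "cmod (u x) \<le> K1 * cmod (e x)" and dub: "cmod (du x) \<le> K2 * cmod (e x)" for x
    using K[OF q[of x]] unfolding u_def du_def norm_mult[of _ "e x"] by (auto intro!: mult_right_mono)
  have K0: "K1 \<ge> 0" "K2 \<ge> 0"
    using order_trans[OF norm_ge_zero K1[of 0]] order_trans[OF norm_ge_zero K2[of 0]] a by auto
  have u2: "u \<in> Lp 2" and du2: "du \<in> Lp 2"
    by (rule Lp2_bounded[OF _ e2 ub] Lp2_bounded[OF _ e2 dub], simp)+
  let ?M = "cmod c + cmod (k\<^sup>2)"
  have Mb: "cmod (c * indicator {-a..a} x - k\<^sup>2) \<le> ?M" for x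
    by (rule order_trans[OF norm_triangle_ineq4]) (auto simp: indicator_def)
  have d2ub: "cmod (d2u x) \<le> ?M * cmod (u x)" for x
    unfolding d2u_def norm_mult[of _ "u x"] using Mb by (intro mult_right_mono) auto
  have d2u2: "d2u \<in> Lp 2"
    by (rule Lp2_bounded[OF _ u2 d2ub]) (simp add: d2u_def)
  have loc: "(f has_vector_derivative f') (at x)"
    if "(g has_vector_derivative f') (at x)" "open U" "x \<in> U" "\<And>y. y \<in> U \<Longrightarrow> g y = f y"
    for f g :: "real \<Rightarrow> complex" and f' x U
    using that by (rule has_vector_derivative_transform_within_open)
  have der_e: "((\<lambda>y. C * exp (\<i> * k * of_real (s * y - a))) has_vector_derivative
      \<i> * k * of_real s * (C * exp (\<i> * k * of_real (s * x - a)))) (at x)" for C s x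
  proof -
    have "((\<lambda>y. C * exp (\<i> * k * (of_real s * y - of_real a))) has_field_derivative
        \<i> * k * of_real s * (C * exp (\<i> * k * (of_real s * of_real x - of_real a)))) (at (of_real x))"
      by (auto intro!: derivative_eq_intros)
    from has_vector_derivative_real_field[OF this] show ?thesis
      by simp
  qed
  have "((\<lambda>y. sin (\<kappa> * y)) has_field_derivative \<kappa> * cos (\<kappa> * of_real x)) (at (of_real x))"
    "((\<lambda>y. \<kappa> * cos (\<kappa> * y)) has_field_derivative - \<kappa>\<^sup>2 * sin (\<kappa> * of_real x)) (at (of_real x))" for x
    by (auto intro!: derivative_eq_intros simp: power2_eq_square)
  note der_sin = this(1)[THEN has_vector_derivative_real_field]
    and der_cos = this(2)[THEN has_vector_derivative_real_field]
  \<comment> \<open>Outside the well, \<open>m1\<close> identifies the derivative of the exponential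
    piece with \<open>du\<close>, and \<open>m2\<close> identifies the derivative of
    \<open>du\<close> with \<open>- k\<^sup>2 * u\<close>, which is \<open>d2u\<close> there since
    the potential vanishes.\<close>
  have m1: "\<kappa> * cos (\<kappa> * of_real a) * E = \<i> * k * (sin (\<kappa> * of_real a) * E)" for E
    unfolding match by (simp only: mult.assoc)
  have m2: "\<i> * k * (\<kappa> * cos (\<kappa> * of_real a) * E) = - (k\<^sup>2 * (sin (\<kappa> * of_real a) * E))" for E
    unfolding m1 by (simp add: power2_eq_square algebra_simps)
  have der: "(u has_vector_derivative du x) (at x)" "(du has_vector_derivative d2u x) (at x)"
    if x: "x \<notin> {-a, a}" for x
  proof -
    consider "x < -a" | "-a < x" "x < a" | "x > a"
      using x by force
    then have "(u has_vector_derivative du x) (at x) \<and> (du has_vector_derivative d2u x) (at x)"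
    proof cases
      case 1
      have U: "q y = -a" "e y = exp (\<i> * k * of_real (-1 * y - a))" if "y \<in> {..<-a}" for y
        using that a by (auto simp: q_def r_def e_def)
      have x: "x \<in> {..<-a}"
        using 1 by simp
      have "(u has_vector_derivative \<i> * k * of_real (-1) * (- sin (\<kappa> * a) * e x)) (at x)"
        unfolding U(2)[OF x] by (rule loc[OF der_e _ x]) (simp_all add: U u_def)
      moreover have "\<i> * k * of_real (-1) * (- sin (\<kappa> * a) * e x) = du x"
        using U(1)[OF x] m1[of "e x", symmetric] by (simp add: du_def)
      moreover have "(du has_vector_derivative \<i> * k * of_real (-1) * (\<kappa> * cos (\<kappa> * a) * e x)) (at x)"
        unfolding U(2)[OF x] by (rule loc[OF der_e _ x]) (simp_all add: U du_def)
      moreover have "\<i> * k * of_real (-1) * (\<kappa> * cos (\<kappa> * a) * e x) = d2u x"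
        using U(1)[OF x] m2[of "e x"] 1 by (simp add: d2u_def u_def)
      ultimately show ?thesis
        by (simp only:)
    next
      case 2
      have U: "q y = y" "e y = 1" if "y \<in> {-a<..<a}" for y
        using that a by (auto simp: q_def r_def e_def)
      have x: "x \<in> {-a<..<a}"
        using 2 by simp
      have "(u has_vector_derivative \<kappa> * cos (\<kappa> * of_real x)) (at x)"
        by (rule loc[OF der_sin _ x]) (simp_all add: U u_def)
      moreover have "(du has_vector_derivative - \<kappa>\<^sup>2 * sin (\<kappa> * of_real x)) (at x)"
        by (rule loc[OF der_cos _ x]) (simp_all add: U du_def)
      ultimately show ?thesis
        using 2 U[OF x] by (simp add: du_def d2u_def u_def energy)
    next
      case 3
      have U: "q y = a" "e y = exp (\<i> * k * of_real (1 * y - a))" if "y \<in> {a<..}" for y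
        using that a by (auto simp: q_def r_def e_def)
      have x: "x \<in> {a<..}"
        using 3 by simp
      have "(u has_vector_derivative \<i> * k * of_real (1) * (sin (\<kappa> * a) * e x)) (at x)"
        unfolding U(2)[OF x] by (rule loc[OF der_e _ x]) (simp_all add: U u_def)
      moreover have "\<i> * k * of_real (1) * (sin (\<kappa> * a) * e x) = du x"
        using U(1)[OF x] m1[of "e x", symmetric] by (simp add: du_def)
      moreover have "(du has_vector_derivative \<i> * k * of_real (1) * (\<kappa> * cos (\<kappa> * a) * e x)) (at x)"
        unfolding U(2)[OF x] by (rule loc[OF der_e _ x]) (simp_all add: U du_def)
      moreover have "\<i> * k * of_real (1) * (\<kappa> * cos (\<kappa> * a) * e x) = d2u x"
        using U(1)[OF x] m2[of "e x"] 3 by (simp add: d2u_def u_def)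
      ultimately show ?thesis
        by (simp only:)
    qed
    then show "(u has_vector_derivative du x) (at x)" "(du has_vector_derivative d2u x) (at x)"
      by auto
  qed
  have "(u, \<lambda>x. k\<^sup>2 * u x) \<in> schroedinger_operator (\<lambda>x. c * indicator {-a..a} x)"
  proof (rule schroedinger_eigenfunction[OF u2 du2 d2u2 cont _ der, where S = "{-a, a}" and B = K2 and L = "?M * K1"])
    show "cmod (du x) \<le> K2" for x
      using dub[of x] mult_left_mono[OF e1[of x] K0(2)] by simp
    have "cmod (u x) \<le> K1" for x
      using ub[of x] mult_left_mono[OF e1[of x] K0(1)] by simp
    then have "?M * cmod (u x) \<le> ?M * K1" for x
      by (intro mult_left_mono) auto
    then show "cmod (d2u x) \<le> ?M * K1" for x
      using d2ub[of x] by (rule order_trans[rotated])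
    show "c * indicator {-a..a} x * u x = d2u x + k\<^sup>2 * u x" for x
      by (simp add: d2u_def left_diff_distrib)
  qed auto
  moreover have "u a \<noteq> 0"
  proof
    assume "u a = 0"
    then have "sin (\<kappa> * of_real a) = 0"
      using a by (simp add: u_def q_def e_def)
    with match \<open>\<kappa> \<noteq> 0\<close> have "cos (\<kappa> * of_real a) = 0"
      by simp
    with \<open>sin (\<kappa> * of_real a) = 0\<close> show False
      using sin_cos_squared_add[of "\<kappa> * of_real a"] by (simp del: sin_cos_squared_add)
  qed
  ultimately show ?thesis
    by (rule eigenvalue_in_spectrum[OF _ u2 cont(1)])
qed

section \<open>The transcendental equation for the eigenvalues\<close>

text \<open>\<open>2 * Ln w - Ln (\<i> * of_real h)\<close> is one logarithm of
  \<open>w\<^sup>2 / (\<i> * of_real h)\<close>; taking \<open>N\<close> among the multiples of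
  \<open>2 * pi\<close> selects the branch. The principal \<open>Ln\<close> is holomorphic on the
  right half-plane, where all the balls used below lie.\<close>

definition well_map :: "real \<Rightarrow> real \<Rightarrow> complex \<Rightarrow> complex" where
  "well_map h N w = of_real N + \<i> * of_real h / w - \<i> * (2 * Ln w - Ln (\<i> * of_real h))"

lemma cball_half_bounds:
  assumes "w \<in> cball (of_real N) (N / 2)"
  shows "Re w \<ge> N / 2" "cmod w \<ge> N / 2" "cmod w \<le> 3 * N / 2"
proof -
  have d: "cmod (w - of_real N) \<le> N / 2"
    using assms by (simp add: dist_norm norm_minus_commute)
  show "Re w \<ge> N / 2"
    using abs_Re_le_cmod[of "w - of_real N"] d by simp
  then show "cmod w \<ge> N / 2"
    using complex_Re_le_cmod[of w] by simp
  show "cmod w \<le> 3 * N / 2"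
    using norm_triangle_ineq[of "w - of_real N" "of_real N"] d norm_ge_zero[of "w - of_real N"]
    by simp
qed

lemma well_map_deriv:
  assumes "Re w > 0"
  shows "(well_map h N has_field_derivative (- \<i> * of_real h / w\<^sup>2 - 2 * \<i> / w)) (at w within A)"
proof -
  have "w \<notin> \<real>\<^sub>\<le>\<^sub>0" "w \<noteq> 0"
    using assms by (auto simp: complex_nonpos_Reals_iff)
  then show ?thesis
    unfolding well_map_def [abs_def]
    by (auto intro!: derivative_eq_intros has_field_derivative_at_within[OF has_field_derivative_Ln]
        simp: power2_eq_square inverse_eq_divide)
qed

text \<open>Banach's theorem on a ball of radius \<open>N / 2\<close>: with Lipschitz constant 1/2
  an image moves at most \<open>N / 4\<close> from the image of the centre, so it is enough that the
  centre itself moves at most \<open>N / 4\<close>. The hypothesis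
  \<open>N \<ge> 6 * q\<^sup>2\<close> keeps the \<open>h / w\<^sup>2\<close> part of the derivative
  below 1/9, and \<open>q \<ge> 4\<close> gives \<open>N \<ge> 96\<close>, which keeps
  \<open>2 / w\<close> below 1/24.\<close>

lemma well_map_fixed_point:
  fixes q N :: real
  assumes q: "q \<ge> 4" and N: "N \<ge> 6 * q\<^sup>2"
  obtains w where "w \<in> cball (of_real N) (N / 2)" "well_map (q ^ 4) N w = w"
proof -
  let ?F = "well_map (q ^ 4) N" and ?S = "cball (of_real N) (N / 2) :: complex set"
  have q2: "q\<^sup>2 \<ge> 16"
    using power_mono[of 4 q 2] q by simp
  have q4: "q ^ 4 = (q\<^sup>2)\<^sup>2"
    by simp
  have N96: "N \<ge> 96"
    using N q2 by simp
  have qN: "36 * q ^ 4 \<le> N\<^sup>2"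
    using power_mono[OF N, of 2] q2 by (simp add: power_mult_distrib)
  have lip: "cmod (?F x - ?F y) \<le> 1 / 2 * cmod (x - y)" if "x \<in> ?S" "y \<in> ?S" for x y
  proof (rule field_differentiable_bound[OF convex_cball _ _ that])
    fix w assume w: "w \<in> ?S"
    note b = cball_half_bounds[OF w]
    show "(?F has_field_derivative (- \<i> * of_real (q ^ 4) / w\<^sup>2 - 2 * \<i> / w)) (at w within ?S)"
      using b(1) N96 by (intro well_map_deriv) simp
    have "cmod (- \<i> * of_real (q ^ 4) / w\<^sup>2 - 2 * \<i> / w) \<le> q ^ 4 / (cmod w)\<^sup>2 + 2 / cmod w"
      by (rule order_trans[OF norm_triangle_ineq4]) (simp add: norm_divide norm_mult norm_power)
    also have "\<dots> \<le> q ^ 4 / (N / 2)\<^sup>2 + 2 / (N / 2)"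
      using b(2) N96 by (intro add_mono divide_left_mono power_mono mult_pos_pos) auto
    also have "\<dots> \<le> 1 / 9 + 1 / 24"
      using qN N96 by (intro add_mono) (auto simp: power_divide field_simps)
    finally show "cmod (- \<i> * of_real (q ^ 4) / w\<^sup>2 - 2 * \<i> / w) \<le> 1 / 2"
      by simp
  qed
  have center: "cmod (?F (of_real N) - of_real N) \<le> N / 4"
  proof -
    have LnN: "Ln (of_real N) = of_real (ln N)"
      using N96 by (intro Ln_of_real) auto
    have Lnc: "Ln (\<i> * of_real (q ^ 4)) = of_real (ln (q ^ 4)) + \<i> * of_real (pi / 2)"
      using q Ln_of_real[of "q ^ 4"] by (subst Ln_times_ii) auto
    define D where "D = 2 * ln N - ln (q ^ 4)"
    have D_eq: "D = 2 * ln (N / q\<^sup>2)"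
      using q N96 by (simp add: D_def ln_div ln_realpow)
    have one: "N / q\<^sup>2 \<ge> 6"
      using N q2 by (subst pos_le_divide_eq) auto
    \<comment> \<open>The bound \<open>ln t \<le> t - 1\<close> leaves a surplus of -2, which later
      absorbs \<open>pi / 2\<close>.\<close>
    have D: "0 \<le> D" "D \<le> 2 * (N / q\<^sup>2) - 2"
      using ln_ge_zero[of "N / q\<^sup>2"] ln_le_minus_one[of "N / q\<^sup>2"] one by (auto simp: D_eq)
    have "?F (of_real N) - of_real N = \<i> * of_real (q ^ 4 / N) - \<i> * (of_real D - \<i> * of_real (pi / 2))"
      unfolding well_map_def LnN Lnc D_def by simp
    also have "cmod \<dots> \<le> q ^ 4 / N + (D + pi / 2)"
    proof -
      have "cmod (\<i> * of_real (q ^ 4 / N)) = q ^ 4 / N"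
        using N96 by (simp add: norm_mult norm_divide norm_power)
      moreover have "cmod (\<i> * (of_real D - \<i> * of_real (pi / 2))) \<le> D + pi / 2"
        unfolding norm_mult using D(1) by (intro order_trans[OF mult_left_mono[OF norm_triangle_ineq4]]) (auto simp: norm_mult norm_divide)
      ultimately show ?thesis
        using norm_triangle_ineq4[of "\<i> * of_real (q ^ 4 / N)" "\<i> * (of_real D - \<i> * of_real (pi / 2))"] by linarith
    qed
    also have "q ^ 4 / N \<le> N / 36"
      using qN N96 by (simp add: field_simps power2_eq_square)
    also have "D + pi / 2 \<le> 2 * (N / q\<^sup>2)"
      using D(2) pi_less_4 by linarith
    also have "2 * (N / q\<^sup>2) \<le> 2 * (N / 16)"
      using q2 N96 by (intro mult_left_mono divide_left_mono) auto
    finally show ?thesis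
      using N96 by simp
  qed
  have "\<exists>!x\<in>?S. ?F x = x"
  proof (rule Banach_fix)
    show "complete ?S"
      by (simp add: complete_eq_closed)
    show "?S \<noteq> {}"
      using N96 by simp
    show "?F ` ?S \<subseteq> ?S"
    proof clarify
      fix x assume x: "x \<in> ?S"
      have cN: "of_real N \<in> ?S"
        using N96 by simp
      have "cmod (?F x - ?F (of_real N)) \<le> 1 / 2 * (N / 2)"
        using lip[OF x cN] x by (simp add: dist_norm norm_minus_commute)
      then have "cmod (?F x - of_real N) \<le> N / 2"
        using center norm_triangle_ineq[of "?F x - ?F (of_real N)" "?F (of_real N) - of_real N"] by simp
      then show "?F x \<in> ?S"
        by (simp add: dist_norm norm_minus_commute)
    qed
    show "dist (?F x) (?F y) \<le> 1 / 2 * dist x y" if "x \<in> ?S" "y \<in> ?S" for x y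
      using lip[OF that] by (simp only: dist_norm)
  qed auto
  then show ?thesis
    using that by blast
qed

text \<open>The parametrisation gives \<open>k + \<kappa> = w\<close> and
  \<open>k - \<kappa> = \<i> * h / w\<close>, so the energy relation is automatic. Exponentiating
  the fixed point equation yields
  \<open>exp (2 * \<i> * \<kappa>) = (k + \<kappa>) / (k - \<kappa>)\<close>, which is the matching
  condition written with exponentials; integrality of \<open>n\<close> enters through
  \<open>exp (2 * pi * \<i> * n) = 1\<close>.\<close>

lemma well_map_fixed_point_matching:
  fixes w k \<kappa> :: complex
  assumes w: "well_map h (2 * pi * real n) w = w" "w \<noteq> 0" and h: "h > 0"
  defines "k \<equiv> (w + \<i> * of_real h / w) / 2" and "\<kappa> \<equiv> (w - \<i> * of_real h / w) / 2"
  shows "\<kappa> * cos \<kappa> = \<i> * k * sin \<kappa>"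
proof -
  let ?c = "\<i> * of_real h"
  have c: "?c \<noteq> 0"
    using h by simp
  have "w - ?c / w = of_real (2 * pi * real n) - \<i> * (2 * Ln w - Ln ?c)"
    using w(1) unfolding well_map_def by (simp add: algebra_simps)
  then have "\<i> * (2 * \<kappa>) = \<i> * (of_real (2 * pi * real n) - \<i> * (2 * Ln w - Ln ?c))"
    by (simp add: \<kappa>_def)
  also have "\<dots> = \<i> * of_real (2 * pi * real n) + (Ln w + Ln w - Ln ?c)"
    by (simp add: algebra_simps)
  finally have "exp (\<i> * (2 * \<kappa>)) = exp (\<i> * of_real (2 * pi * real n)) * (w * w / ?c)"
    by (simp only: exp_add exp_diff exp_Ln[OF w(2)] exp_Ln[OF c])
  also have "exp (\<i> * of_real (2 * pi * real n)) = 1"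
    using exp_integer_2pi[of "of_nat n"] by (simp add: mult_ac)
  finally have E2: "exp (\<i> * \<kappa>) * exp (\<i> * \<kappa>) = w * w / ?c"
    by (simp add: algebra_simps flip: exp_add)
  define E where "E = exp (\<i> * \<kappa>)"
  have E: "E \<noteq> 0" "E * E * ?c = w * w"
    using E2 c by (auto simp: E_def divide_simps)
  have cossin: "cos \<kappa> = (E + inverse E) / 2" "\<i> * sin \<kappa> = (E - inverse E) / 2"
    by (simp_all add: cos_exp_eq sin_exp_eq E_def exp_minus divide_simps)
  have "(\<kappa> - k) * (E * E) = - (k + \<kappa>)"
    using E w(2) by (simp add: \<kappa>_def k_def field_simps)
  then have "\<kappa> * (E + inverse E) = k * (E - inverse E)"
    using E(1) by (simp add: field_simps)
  then have "\<kappa> * cos \<kappa> = k * (\<i> * sin \<kappa>)"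
    by (simp add: cossin)
  then show ?thesis
    by (simp only: mult_ac)
qed

text \<open>With \<open>w = x + \<i> * y\<close> and \<open>m = x\<^sup>2 + y\<^sup>2\<close>,
  \<open>Im (k\<^sup>2)\<close> equals \<open>(h + (1 + t) * (x * y)) / 2\<close>, where
  \<open>t = (h / m)\<^sup>2 \<le> 1\<close>. Only a very negative \<open>x * y\<close> could spoil
  it. The imaginary part of the fixed point equation gives \<open>y \<ge> - Y\<close> with
  \<open>Y = ln (m / h)\<close>, and the logarithmic condition on \<open>q\<close> makes
  \<open>cmod w * Y\<close> at most \<open>h / 4\<close>.\<close>

lemma well_map_fixed_point_energy:
  fixes q :: real and w :: complex
  assumes q: "q \<ge> 4" "80 * ln (10 * q) \<le> q" and n: "q\<^sup>2 \<le> real n" "real n \<le> q ^ 3"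
    and w: "w \<in> cball (of_real (2 * pi * real n)) (2 * pi * real n / 2)"
      "well_map (q ^ 4) (2 * pi * real n) w = w"
  defines "k \<equiv> (w + \<i> * of_real (q ^ 4) / w) / 2"
  shows "Re k > 0" "Im k > 0" "Im (k\<^sup>2) \<ge> q ^ 4 / 4" "cmod k \<le> 10 * real n"
proof -
  define h where "h = q ^ 4"
  define N where "N = 2 * pi * real n"
  note b = cball_half_bounds[OF w(1), folded N_def]
  have h: "h = (q\<^sup>2)\<^sup>2" "h > 0"
    using q by (auto simp: h_def)
  have q2: "q\<^sup>2 \<ge> 16"
    using power_mono[of 4 q 2] q by simp
  have N6: "N \<ge> 6 * q\<^sup>2"
    unfolding N_def using n(1) pi_gt3 by (intro mult_mono) auto
  \<comment> \<open>The constant 10 in the bound on \<open>k\<close> comes from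
    \<open>3 * pi < 10\<close>.\<close>
  have N10: "3 * N / 2 \<le> 10 * real n"
    unfolding N_def using mult_right_mono[of "3 * pi" 10 "real n"] pi_approx by simp
  have w3: "cmod w \<ge> 3 * q\<^sup>2" "cmod w > 0"
    using b(2) N6 q2 by auto
  have w10: "cmod w \<le> 10 * real n"
    using b(3) N10 by simp
  have "9 * h \<le> (cmod w)\<^sup>2"
    using power_mono[OF w3(1), of 2] q2 by (simp add: h power_mult_distrib)
  then have hw: "h \<le> (cmod w)\<^sup>2" "h / (cmod w)\<^sup>2 \<le> 1 / 9"
    using w3(2) h(2) by (auto simp: divide_simps)
  define x y m where "x = Re w" and "y = Im w" and "m = (cmod w)\<^sup>2"
  have m: "m = x\<^sup>2 + y\<^sup>2" "m > 0"
    using zero_less_power[OF w3(2), of 2] by (auto simp: m_def x_def y_def cmod_power2)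
  have cw: "\<i> * of_real h / w = Complex (h * y / m) (h * x / m)"
    by (simp add: complex_eq_iff Re_divide Im_divide m(1) x_def y_def)
  have Rek: "Re k = (x + h * y / m) / 2" and Imk: "Im k = (y + h * x / m) / 2"
    by (simp_all add: k_def cw x_def y_def flip: h_def)
  have xw: "0 < x" "x \<le> cmod w"
    using b(1) N6 q2 complex_Re_le_cmod[of w] by (auto simp: x_def)
  \<comment> \<open>The correction \<open>h * y / m\<close> is at most \<open>cmod w / 9\<close>,
    and \<open>cmod w \<le> 3 * x\<close> on the ball. Positivity of \<open>Re k\<close> later
    distinguishes \<open>k\<close> from \<open>- k\<close>, and it turns positivity of
    \<open>Re k * Im k\<close> into \<open>Im k > 0\<close>.\<close>
  show "Re k > 0"
  proof -
    have "\<bar>h * y / m\<bar> = h / m * \<bar>y\<bar>"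
      using h(2) m(2) by (simp add: abs_mult)
    also have "\<dots> \<le> 1 / 9 * cmod w"
      using hw(2) h(2) m(2) abs_Im_le_cmod[of w] unfolding m_def y_def by (intro mult_mono) auto
    also have "\<dots> \<le> 1 / 9 * (3 * x)"
      using b(1,3) by (simp add: x_def)
    finally have "x + h * y / m > 0"
      using xw(1) by linarith
    then show ?thesis
      by (simp add: Rek)
  qed
  define Y where "Y = 2 * ln (cmod w) - ln h"
  have "Im w = Im (\<i> * of_real h / w) - Re (2 * Ln w - Ln (\<i> * of_real h))"
    using arg_cong[OF w(2), of Im] unfolding well_map_def h_def[symmetric] by simp
  also have "Re (2 * Ln w - Ln (\<i> * of_real h)) = Y"
    using w3(2) h(2) by (auto simp: Y_def norm_mult)
  finally have y: "y = h * x / m - Y"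
    by (simp add: cw y_def)
  have Y: "Y = 2 * ln (cmod w / q\<^sup>2)"
    using w3(2) q by (simp add: Y_def h(1) ln_div ln_realpow)
  have "cmod w / q\<^sup>2 \<le> 10 * q"
    using w10 n(2) q by (simp add: divide_simps power2_eq_square power3_eq_cube mult_ac)
  moreover have "cmod w / q\<^sup>2 \<ge> 1"
    using w3(1) q2 q by (simp add: divide_simps)
  ultimately have Y01: "0 \<le> Y" "Y \<le> 2 * ln (10 * q)"
    by (auto simp: Y)
  \<comment> \<open>Here the upper limit \<open>n \<le> q ^ 3\<close> is used: one factor
    \<open>q\<close> is left over to beat the logarithm, and 80 is
    \<open>4 * 10 * 2\<close>.\<close>
  have "cmod w * Y \<le> (10 * q ^ 3) * (2 * ln (10 * q))"
    using w10 n(2) Y01 q by (intro mult_mono) auto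
  also have "\<dots> = q ^ 3 * (80 * ln (10 * q)) / 4"
    by simp
  also have "\<dots> \<le> q ^ 3 * q / 4"
    using q by (intro divide_right_mono mult_left_mono) auto
  also have "\<dots> = h / 4"
    by (simp add: h_def power_Suc2 flip: power_Suc2)
  finally have wY: "cmod w * Y \<le> h / 4" .
  have xy: "x * y \<ge> - (cmod w * Y)"
  proof -
    have "- Y \<le> y"
      using y xw(1) h(2) m(2) by simp
    then have "x * (- Y) \<le> x * y"
      using xw(1) by (intro mult_left_mono) auto
    moreover have "x * Y \<le> cmod w * Y"
      using xw(2) Y01(1) by (intro mult_right_mono) auto
    ultimately show ?thesis
      by simp
  qed
  define t where "t = (h / m)\<^sup>2"
  have t: "0 \<le> t" "t \<le> 1"
    using hw(2) h(2) m(2) unfolding t_def m_def by (auto intro!: power_le_one)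
  have "Im (k\<^sup>2) = 2 * Re k * Im k"
    by (simp add: power2_eq_square)
  also have "\<dots> = (x * y + h * (x\<^sup>2 + y\<^sup>2) / m + t * (x * y)) / 2"
    using m(2) by (simp add: Rek Imk t_def field_simps power2_eq_square)
  also have "h * (x\<^sup>2 + y\<^sup>2) / m = h"
    using m(2) by (simp flip: m(1))
  finally have Im_eq: "Im (k\<^sup>2) = (h + (1 + t) * (x * y)) / 2"
    by (simp add: algebra_simps)
  have "(1 + t) * (x * y) \<ge> (1 + t) * (- (h / 4))"
    using xy wY t by (intro mult_left_mono) auto
  moreover have "(1 + t) * (- (h / 4)) \<ge> 2 * (- (h / 4))"
    using t h(2) by (intro mult_right_mono_neg) auto
  ultimately have "(1 + t) * (x * y) \<ge> - (h / 2)"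
    by linarith
  then show Imk2: "Im (k\<^sup>2) \<ge> q ^ 4 / 4"
    unfolding Im_eq h_def[symmetric] by simp
  then have "h \<le> 8 * (Re k * Im k)"
    by (simp add: power2_eq_square h_def mult_ac)
  then have "Re k * Im k > 0"
    using h(2) by linarith
  then show "Im k > 0"
    using \<open>Re k > 0\<close> by (simp add: zero_less_mult_iff)
  have "cmod (\<i> * of_real h / w) \<le> cmod w"
    using hw(1) w3(2) h(2) by (simp add: norm_divide norm_mult divide_simps power2_eq_square)
  then have "cmod (w + \<i> * of_real h / w) \<le> 2 * cmod w"
    using norm_triangle_ineq[of w "\<i> * of_real h / w"] by simp
  then show "cmod k \<le> 10 * real n"
    using w10 by (simp add: k_def norm_divide h_def)
qed

text \<open>The only other preimage of \<open>w + c / w\<close> is \<open>c / w\<close>; the modulus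
  condition excludes it.\<close>

lemma Joukowski_inj:
  fixes w w' c :: complex
  assumes "w + c / w = w' + c / w'" "cmod c < cmod w * cmod w'"
  shows "w = w'"
proof -
  have 0: "w \<noteq> 0" "w' \<noteq> 0"
    using assms(2) norm_ge_zero[of c] by auto
  then have "(w - w') * (w * w' - c) = 0"
    using assms(1) by (simp add: field_simps)
  moreover have "w * w' \<noteq> c"
    using assms(2) by (auto simp: norm_mult)
  ultimately show ?thesis
    by simp
qed

lemma sum_inverse_ge_ln:
  fixes a b :: nat
  assumes "0 < a" "a \<le> b"
  shows "(\<Sum>n = a..<b. 1 / real n) \<ge> ln (real b / real a)"
  using assms(2)
proof (induction b rule: dec_induct)
  case base
  then show ?case
    using assms(1) by simp
next
  case (step b)
  have b: "real b > 0"
    using step assms(1) by simp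
  have "ln (real (Suc b) / real a) = ln (real b / real a) + ln (1 + 1 / real b)"
  proof -
    have "real (Suc b) / real a = real b / real a * (1 + 1 / real b)"
      using b assms(1) by (simp add: divide_simps)
    also have "ln \<dots> = ln (real b / real a) + ln (1 + 1 / real b)"
      using b assms(1) by (intro ln_mult_pos) (auto intro: add_pos_pos)
    finally show ?thesis .
  qed
  also have "ln (1 + 1 / real b) \<le> 1 / real b"
    using b by (intro ln_add_one_self_le_self) simp
  finally show ?case
    using step by simp
qed

section \<open>Divergence of the eigenvalue sums\<close>

text \<open>Dilation by \<open>s\<close> multiplies wave numbers by \<open>s\<close> and the
  potential by \<open>s\<^sup>2\<close>, and shrinks or stretches the half-width to
  \<open>1 / s\<close>. The product of \<kappa> with the half-width is unchanged, so the matching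
  condition of the unit well still applies.\<close>

lemma dilated_well_eigenvalue:
  fixes w :: complex and h s :: real
  assumes s: "s > 0" and h: "h > 0"
    and w: "well_map h (2 * pi * real n) w = w" "h < (cmod w)\<^sup>2"
  defines "k \<equiv> (w + \<i> * of_real h / w) / 2"
  assumes k: "Im k > 0"
  shows "(of_real s * k)\<^sup>2 \<in> spectrum (schroedinger_operator
    (\<lambda>x. (of_real (s\<^sup>2 * h) * \<i>) * indicator {- (1 / s)..1 / s} x))"
proof (rule square_well_eigenvalue)
  define \<kappa> where "\<kappa> = (w - \<i> * of_real h / w) / 2"
  have w0: "w \<noteq> 0"
    using w(2) h by auto
  show "1 / s > 0"
    using s by simp
  show "Im (of_real s * k) > 0"
    using s k by simp
  show "of_real s * \<kappa> \<noteq> 0"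
  proof
    assume "of_real s * \<kappa> = 0"
    then have "w * w = \<i> * of_real h"
      using s w0 by (simp add: \<kappa>_def field_simps)
    then have "cmod w * cmod w = h"
      using h by (metis norm_mult norm_ii mult_1 norm_of_real abs_of_pos)
    then show False
      using w(2) by (simp add: power2_eq_square)
  qed
  have "of_real s * \<kappa> * of_real (1 / s) = \<kappa>"
    using s by simp
  moreover have "\<kappa> * cos \<kappa> = \<i> * k * sin \<kappa>"
    unfolding k_def \<kappa>_def using w(1) w0 h by (rule well_map_fixed_point_matching)
  ultimately show "of_real s * \<kappa> * cos (of_real s * \<kappa> * of_real (1 / s))
      = \<i> * (of_real s * k) * sin (of_real s * \<kappa> * of_real (1 / s))"
    by (simp add: mult_ac)
  have "k\<^sup>2 - \<kappa>\<^sup>2 = (k - \<kappa>) * (k + \<kappa>)"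
    by (simp add: power2_eq_square algebra_simps)
  also have "\<dots> = \<i> * of_real h"
    using w0 by (simp add: k_def \<kappa>_def flip: diff_divide_distrib add_divide_distrib)
  finally show "(of_real s * k)\<^sup>2 = (of_real s * \<kappa>)\<^sup>2 + of_real (s\<^sup>2 * h) * \<i>"
    by (simp add: power_mult_distrib algebra_simps)
qed

lemma Lp_norm_square_well:
  fixes c :: complex and a p :: real
  assumes "p \<ge> 1" "a > 0"
  shows "(\<lambda>x. c * indicator {-a..a} x) \<in> Lp p"
    and "Lp_norm p (\<lambda>x. c * indicator {-a..a} x) powr p = cmod c powr p * (2 * a)"
proof -
  have eq: "(\<lambda>x. cmod (c * indicator {-a..a} x) powr p) = (\<lambda>x. cmod c powr p * indicator {-a..a} x)"
    using assms by (auto simp: indicator_def)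
  have int: "integrable lborel (indicat_real {-a..a})"
    by (intro integrable_real_indicator) (auto simp: emeasure_lborel_Icc_eq)
  show "(\<lambda>x. c * indicator {-a..a} x) \<in> Lp p"
    using int by (simp add: Lp_def eq)
  show "Lp_norm p (\<lambda>x. c * indicator {-a..a} x) powr p = cmod c powr p * (2 * a)"
    using assms by (simp add: Lp_norm_def eq powr_powr)
qed

lemma sum_le_infsum_ennreal:
  fixes f :: "'a \<Rightarrow> ennreal"
  assumes "finite B" "B \<subseteq> A"
  shows "sum f B \<le> infsum f A"
  by (subst nonneg_infsum_complete) (use assms in \<open>auto intro!: SUP_upper\<close>)

lemma abs_Im_le_infdist_nonneg_Reals: "\<bar>Im z\<bar> \<le> infdist z \<real>\<^sub>\<ge>\<^sub>0"
proof -
  have "\<bar>Im z\<bar> \<le> dist z a" if "a \<in> \<real>\<^sub>\<ge>\<^sub>0" for a :: complex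
    using abs_Im_le_cmod[of "z - a"] that by (simp add: dist_norm complex_nonneg_Reals_iff)
  moreover have "(\<real>\<^sub>\<ge>\<^sub>0 :: complex set) \<noteq> {}"
    using nonneg_Reals_zero_I by blast
  ultimately show ?thesis
    by (subst infdist_notempty) (auto intro!: cINF_greatest)
qed

text \<open>Each eigenvalue contributes at least
  \<open>(s\<^sup>2 * h / 4) powr p / (10 * s * n)\<close>, while the norm is
  \<open>(s\<^sup>2 * h) powr p * (2 / s)\<close>. In the quotient \<open>s\<close> and
  \<open>h\<close> cancel, and only the harmonic sum and the constant
  \<open>(1 / 4) powr p / 20\<close> survive.\<close>

lemma well_sum_lower_bound:
  fixes p \<sigma> :: real and q :: nat
  assumes p: "p \<ge> 1" and \<sigma>: "\<sigma> \<ge> 1 / 2" and q: "q \<ge> 4" "80 * ln (10 * real q) \<le> real q"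
  shows "\<exists>V\<in>{V \<in> Lp p. \<not> (AE x in lborel. V x = 0)}.
    ennreal ((1 / 4) powr p / 20 * ln (real q)) \<le> ennreal (1 / Lp_norm p V powr p) *
      (\<Sum>\<^sub>\<infinity>z\<in>discrete_spectrum V. ennreal (infdist z \<real>\<^sub>\<ge>\<^sub>0 powr p / cmod z powr \<sigma>))"
proof -
  \<comment> \<open>A fourth power makes both limits, sqrt h and h^(3/4), integers.\<close>
  define h where "h = real q ^ 4"
  \<comment> \<open>This is the reciprocal of the largest possible bound \<open>10 * n\<close> on
    \<open>cmod (k n)\<close>, so every dilated eigenvalue lies in the closed unit disc.\<close>
  define s where "s = 1 / (10 * real q ^ 3)"
  define I where "I = {q\<^sup>2..<q ^ 3}"
  define V where "V = (\<lambda>x. (of_real (s\<^sup>2 * h) * \<i>) * indicator {- (1 / s)..1 / s} x :: complex)"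
  have h: "h > 0" and s: "s > 0"
    using q by (auto simp: h_def s_def)
  have normc: "cmod (of_real (s\<^sup>2 * h) * \<i>) = s\<^sup>2 * h"
    using h by (simp add: norm_mult norm_power)
  have V_norm: "Lp_norm p V powr p = (s\<^sup>2 * h) powr p * (2 / s)" and V_Lp: "V \<in> Lp p"
    using Lp_norm_square_well[OF p, of "1 / s" "of_real (s\<^sup>2 * h) * \<i>"] s unfolding V_def normc by auto
  have V_nonzero: "\<not> (AE x in lborel. V x = 0)"
  proof
    assume "AE x in lborel. V x = 0"
    then have "AE x in lborel. cmod (V x) powr p = 0"
      by eventually_elim simp
    then have "(\<integral>x. cmod (V x) powr p \<partial>lborel) = 0"
      by (rule integral_eq_zero_AE)
    then have "Lp_norm p V powr p = 0"
      by (simp add: Lp_norm_def)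
    then show False
      using V_norm s h by simp
  qed
  have I: "(real q)\<^sup>2 \<le> real n" "real n \<le> real q ^ 3" "real n > 0" if "n \<in> I" for n
  proof -
    have n: "q\<^sup>2 \<le> n" "n \<le> q ^ 3"
      using that by (auto simp: I_def)
    then show "(real q)\<^sup>2 \<le> real n" "real n \<le> real q ^ 3"
      by (metis of_nat_le_iff of_nat_power)+
    have "0 < q\<^sup>2"
      using q by simp
    then have "0 < n"
      using n(1) by (rule less_le_trans)
    then show "real n > 0"
      by simp
  qed
  have q4: "real q \<ge> 4"
    using q by simp
  have N6: "2 * pi * real n \<ge> 6 * (real q)\<^sup>2" if "n \<in> I" for n
    using I[OF that] pi_gt3 by (intro mult_mono) auto
  have "\<forall>n\<in>I. \<exists>w. w \<in> cball (of_real (2 * pi * real n)) (2 * pi * real n / 2) \<and>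
      well_map h (2 * pi * real n) w = w"
    using well_map_fixed_point[OF q4 N6] unfolding h_def by metis
  then obtain w where "\<forall>n\<in>I. w n \<in> cball (of_real (2 * pi * real n)) (2 * pi * real n / 2) \<and>
      well_map h (2 * pi * real n) (w n) = w n"
    by (rule bchoice[THEN exE])
  then have w: "w n \<in> cball (of_real (2 * pi * real n)) (2 * pi * real n / 2)"
      "well_map h (2 * pi * real n) (w n) = w n" if "n \<in> I" for n
    using that by auto
  define k where "k n = (w n + \<i> * of_real h / w n) / 2" for n
  define z where "z n = (of_real s * k n)\<^sup>2" for n
  have k: "Re (k n) > 0" "Im (k n) > 0" "Im ((k n)\<^sup>2) \<ge> h / 4" "cmod (k n) \<le> 10 * real n"
    if "n \<in> I" for n
    using well_map_fixed_point_energy[OF q4 q(2) I(1,2)[OF that] w(1)[OF that]] w(2)[OF that]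
    unfolding k_def h_def by auto
  have w_large: "cmod (w n) \<ge> 3 * (real q)\<^sup>2" if "n \<in> I" for n
    using cball_half_bounds(2)[OF w(1)[OF that]] N6[OF that] by simp
  have h_less: "h < cmod (w m) * cmod (w n)" if "m \<in> I" "n \<in> I" for m n
  proof -
    have "h < (3 * (real q)\<^sup>2) * (3 * (real q)\<^sup>2)"
      using h by (simp add: h_def flip: power_add)
    also have "\<dots> \<le> cmod (w m) * cmod (w n)"
      using w_large that by (intro mult_mono) auto
    finally show ?thesis .
  qed
  \<comment> \<open>Balls with neighbouring centres overlap, so distinctness is recovered backwards:
    equal squares give equal \<open>k\<close> because both real parts are positive, then equal
    \<open>w\<close>, and two fixed point equations with the same \<open>w\<close> have the same
    \<open>n\<close>.\<close>
  have inj: "inj_on z I"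
  proof (rule inj_onI)
    fix m n assume mn: "m \<in> I" "n \<in> I" and "z m = z n"
    then have "(k m)\<^sup>2 = (k n)\<^sup>2"
      using s by (simp add: z_def power_mult_distrib)
    then have "k m = k n \<or> k m = - k n"
      by (simp add: power2_eq_iff)
    then have "k m = k n"
      using k(1)[OF mn(1)] k(1)[OF mn(2)] by auto
    then have "w m + \<i> * of_real h / w m = w n + \<i> * of_real h / w n"
      unfolding k_def by (simp only: divide_cancel_right) simp
    then have "w m = w n"
      by (rule Joukowski_inj) (use h_less[OF mn] h in \<open>simp add: norm_mult\<close>)
    then have "well_map h (2 * pi * real m) (w m) = well_map h (2 * pi * real n) (w m)"
      using w(2) mn by metis
    then show "m = n"
      by (simp add: well_map_def)
  qed
  have Im_z: "Im (z n) \<ge> s\<^sup>2 * h / 4" if "n \<in> I" for n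
  proof -
    have "Im (z n) = s\<^sup>2 * Im ((k n)\<^sup>2)"
      by (simp add: z_def power2_eq_square algebra_simps)
    then show ?thesis
      using mult_left_mono[OF k(3)[OF that], of "s\<^sup>2"] by simp
  qed
  have Im_pos: "Im (z n) > 0" if "n \<in> I" for n
  proof -
    have "0 < s\<^sup>2 * h / 4"
      using s h by simp
    then show ?thesis
      using Im_z[OF that] by linarith
  qed
  have z_spec: "z ` I \<subseteq> discrete_spectrum V"
  proof clarify
    fix n assume n: "n \<in> I"
    have "z n \<in> spectrum (schroedinger_operator V)"
      unfolding z_def k_def V_def
      by (rule dilated_well_eigenvalue[OF s h w(2)[OF n]])
        (use h_less[OF n n] k(2)[OF n] in \<open>auto simp: power2_eq_square k_def\<close>)
    then show "z n \<in> discrete_spectrum V"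
      using Im_pos[OF n] by (auto simp: discrete_spectrum_def complex_nonneg_Reals_iff)
  qed
  define f where "f z = infdist z \<real>\<^sub>\<ge>\<^sub>0 powr p / cmod z powr \<sigma>" for z :: complex
  define A where "A = (s\<^sup>2 * h / 4) powr p / (10 * s)"
  have A: "A > 0"
    using s h by (simp add: A_def)
  have f_ge: "A * (1 / real n) \<le> f (z n)" if n: "n \<in> I" for n
  proof -
    let ?t = "s * (10 * real n)"
    have t: "?t > 0" "?t \<le> 1"
      using I[OF n] s q by (auto simp: s_def field_simps)
    have zpos: "cmod (z n) > 0"
      using Im_pos[OF n] by auto
    have zt: "cmod (z n) \<le> ?t\<^sup>2"
    proof -
      have "s * cmod (k n) \<le> ?t"
        using k(4)[OF n] s by (intro mult_left_mono) auto
      then have "(s * cmod (k n))\<^sup>2 \<le> ?t\<^sup>2"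
        using s by (intro power_mono) auto
      then show ?thesis
        using s by (simp add: z_def norm_power norm_mult)
    qed
    then have z1: "cmod (z n) \<le> 1"
      using t power_le_one[of ?t 2] by linarith
    \<comment> \<open>For a base in the unit interval raising the exponent lowers the power; this
      reduces every \<sigma> to the critical case 1/2.\<close>
    have "cmod (z n) powr \<sigma> \<le> cmod (z n) powr (1 / 2)"
      using zpos z1 \<sigma> by (intro powr_mono') auto
    also have "\<dots> \<le> ?t\<^sup>2 powr (1 / 2)"
      using zt zpos by (intro powr_mono2) auto
    also have "\<dots> = ?t"
      using t(1) by (simp add: powr_half_sqrt)
    finally have den: "cmod (z n) powr \<sigma> \<le> ?t" .
    have "s\<^sup>2 * h / 4 \<le> infdist (z n) \<real>\<^sub>\<ge>\<^sub>0"
      using Im_z[OF n] abs_Im_le_infdist_nonneg_Reals[of "z n"] by linarith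
    then have num: "(s\<^sup>2 * h / 4) powr p \<le> infdist (z n) \<real>\<^sub>\<ge>\<^sub>0 powr p"
      using s h p by (intro powr_mono2) auto
    have "A * (1 / real n) = (s\<^sup>2 * h / 4) powr p / ?t"
      by (simp add: A_def)
    also have "\<dots> \<le> f (z n)"
      unfolding f_def using num den zpos by (intro frac_le) auto
    finally show ?thesis .
  qed
  have sum_I: "ln (real q) \<le> (\<Sum>n\<in>I. 1 / real n)"
  proof -
    have "q\<^sup>2 \<le> q ^ 3"
      using q by (intro power_increasing) auto
    \<comment> \<open>The ratio of the two index limits is \<open>q\<close>, which is the source of
      the logarithmic growth.\<close>
    then have "ln (real (q ^ 3) / real (q\<^sup>2)) \<le> (\<Sum>n\<in>I. 1 / real n)"
      unfolding I_def using q by (intro sum_inverse_ge_ln) auto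
    also have "real (q ^ 3) / real (q\<^sup>2) = real q"
      using q by (simp add: power2_eq_square power3_eq_cube)
    finally show ?thesis .
  qed
  have "A * ln (real q) \<le> (\<Sum>n\<in>I. A * (1 / real n))"
    using mult_left_mono[OF sum_I, of A] A by (simp only: sum_distrib_left)
  also have "\<dots> \<le> (\<Sum>n\<in>I. f (z n))"
    using f_ge by (intro sum_mono)
  also have "\<dots> = sum f (z ` I)"
    using inj by (simp add: sum.reindex)
  finally have "ennreal (A * ln (real q)) \<le> ennreal (sum f (z ` I))"
    by (rule ennreal_leI)
  also have "\<dots> = (\<Sum>z\<in>z ` I. ennreal (f z))"
    by (simp add: sum_ennreal f_def)
  also have "\<dots> \<le> (\<Sum>\<^sub>\<infinity>z\<in>discrete_spectrum V. ennreal (f z))"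
    using z_spec by (intro sum_le_infsum_ennreal) (auto simp: I_def)
  finally have "ennreal (1 / Lp_norm p V powr p) * ennreal (A * ln (real q))
      \<le> ennreal (1 / Lp_norm p V powr p) * (\<Sum>\<^sub>\<infinity>z\<in>discrete_spectrum V. ennreal (f z))"
    by (rule mult_left_mono) simp
  moreover have "ennreal (1 / Lp_norm p V powr p) * ennreal (A * ln (real q))
      = ennreal ((1 / 4) powr p / 20 * ln (real q))"
  proof -
    have "A = (s\<^sup>2 * h) powr p * (1 / 4) powr p / (10 * s)"
      using s h by (simp add: A_def powr_divide)
    then have "1 / Lp_norm p V powr p * (A * ln (real q)) = (1 / 4) powr p / 20 * ln (real q)"
      using s h by (simp add: V_norm)
    moreover have "ennreal (1 / Lp_norm p V powr p) * ennreal (A * ln (real q))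
        = ennreal (1 / Lp_norm p V powr p * (A * ln (real q)))"
      by (rule ennreal_mult'[symmetric]) simp
    ultimately show ?thesis
      by (simp only:)
  qed
  ultimately show ?thesis
    using V_Lp V_nonzero unfolding f_def by auto
qed

text \<open>The bound of \<open>well_sum_lower_bound\<close> tends to infinity with
  \<open>ln q\<close>, and its side condition holds for all large \<open>q\<close> because the
  logarithm grows more slowly than \<open>q\<close>; so every finite value is exceeded.\<close>

theorem theorem9:
  fixes p \<sigma> :: real
  assumes "p \<ge> 1" and "\<sigma> \<ge> 1 / 2"
  shows "(SUP V \<in> {V \<in> Lp p. \<not> (AE x in lborel. V x = 0)}.
            ennreal (1 / Lp_norm p V powr p) *
            (\<Sum>\<^sub>\<infinity>z\<in>discrete_spectrum V.
               ennreal (infdist z \<real>\<^sub>\<ge>\<^sub>0 powr p / cmod z powr \<sigma>))) = \<infinity>"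
proof -
  have "\<exists>V\<in>{V \<in> Lp p. \<not> (AE x in lborel. V x = 0)}.
      y < ennreal (1 / Lp_norm p V powr p) *
        (\<Sum>\<^sub>\<infinity>z\<in>discrete_spectrum V. ennreal (infdist z \<real>\<^sub>\<ge>\<^sub>0 powr p / cmod z powr \<sigma>))"
    if y: "y < top" for y
  proof -
    obtain M where M: "M \<ge> 0" "y = ennreal M"
      using y by (cases y) auto
    have "filterlim (\<lambda>q::nat. (1 / 4) powr p / 20 * ln (real q)) at_top sequentially"
      by (intro filterlim_tendsto_pos_mult_at_top[OF tendsto_const] filterlim_compose[OF ln_at_top]
          filterlim_real_sequentially) simp
    then have "\<forall>\<^sub>F q in sequentially. M < (1 / 4) powr p / 20 * ln (real q)"
      by (simp add: filterlim_at_top_dense)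
    moreover have "\<forall>\<^sub>F q::nat in sequentially. 80 * ln (10 * real q) \<le> real q"
      by real_asymp
    moreover have "\<forall>\<^sub>F q::nat in sequentially. 4 \<le> q"
      by (rule eventually_ge_at_top)
    ultimately have "\<forall>\<^sub>F q::nat in sequentially. M < (1 / 4) powr p / 20 * ln (real q) \<and>
        80 * ln (10 * real q) \<le> real q \<and> 4 \<le> q"
      by eventually_elim simp
    then obtain q :: nat where q: "M < (1 / 4) powr p / 20 * ln (real q)"
        "80 * ln (10 * real q) \<le> real q" "4 \<le> q"
      unfolding eventually_sequentially by blast
    have "y < ennreal ((1 / 4) powr p / 20 * ln (real q))"
      using q(1) M by (simp add: ennreal_less_iff)
    with well_sum_lower_bound[OF assms q(3,2)] show ?thesis
      by (meson less_le_trans)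
  qed
  then show ?thesis
    unfolding infinity_ennreal_def by (subst SUP_eq_top_iff) blast
qed

end
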